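(* Let $G$ be a finite group and let $\mathfrak{N}^*$ be the class of all finite quasinilpotent groups. The intersection of all maximal quasinilpotent subgroups of $G$ is $\mathrm{Z}_{\mathfrak{N}^*}(G)$, the $\mathfrak{N}^*$-hypercenter of $G$.
   Context: All groups are finite. A group $G$ is quasinilpotent if for every chief factor $H/K$ of $G$ and every $x\in G$, the automorphism of $H/K$ induced by conjugation by $x$ is an inner automorphism of $H/K$. $\mathfrak{N}^*$ denotes the class of all quasinilpotent groups. A maximal quasinilpotent subgroup of $G$ is a quasinilpotent subgroup of $G$ that is not properly contained in any quasinilpotent subgroup of $G$. Let $\mathfrak{X}$ be a class of groups. A chief factor $H/K$ of a group $G$ is called $\mathfrak{X}$-central (in $G$) if the semidirect product $(H/K)\rtimes (G/C_G(H/K))$, formed with respect to the action of $G/C_G(H/K)$ on $H/K$ induced by conjugation, belongs to $\mathfrak{X}$. A normal subgroup $N$ of $G$ is $\mathfrak{X}$-hypercentral in $G$ if $N=1$, or $N\neq 1$ and every chief factor $H/K$ of $G$ below $N$ (i.e. with $H\le N$) is $\mathfrak{X}$-central. The $\mathfrak{X}$-hypercenter $\mathrm{Z}_{\mathfrak{X}}(G)$ is the product of all normal $\mathfrak{X}$-hypercentral subgroups of $G$. *)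

theory Defs
  imports "HOL-Algebra.Generated_Groups" "HOL-Algebra.SndIsomorphismGrp"
begin

definition chief_factor :: "('a, 'b) monoid_scheme \<Rightarrow> 'a set \<Rightarrow> 'a set \<Rightarrow> bool" where
  "chief_factor G H K \<longleftrightarrow>
     H \<lhd> G \<and> K \<lhd> G \<and> K \<subset> H \<and> (\<nexists>L. L \<lhd> G \<and> K \<subset> L \<and> L \<subset> H)"

(* The quotient group H/K of two subgroups of G. *)
abbreviation factor :: "('a, 'b) monoid_scheme \<Rightarrow> 'a set \<Rightarrow> 'a set \<Rightarrow> 'a set monoid" where
  "factor G H K \<equiv> (G\<lparr>carrier := H\<rparr>) Mod K"

(* Conjugation acts from the left, Kh being sent to K(g h g^-1). The set g <# X #> inv g is
   this coset when X = Kh. Like the elements of AutoGroup, maps are extensional. *)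
definition conj_factor ::
    "('a, 'b) monoid_scheme \<Rightarrow> 'a set \<Rightarrow> 'a set \<Rightarrow> 'a \<Rightarrow> 'a set \<Rightarrow> 'a set" where
  "conj_factor G H K g =
     (\<lambda>X\<in>carrier (factor G H K). (g <#\<^bsub>G\<^esub> X) #>\<^bsub>G\<^esub> (inv\<^bsub>G\<^esub> g))"

definition inner_auto :: "('a, 'b) monoid_scheme \<Rightarrow> ('a \<Rightarrow> 'a) set" where
  "inner_auto Q = {(\<lambda>x\<in>carrier Q. y \<otimes>\<^bsub>Q\<^esub> x \<otimes>\<^bsub>Q\<^esub> inv\<^bsub>Q\<^esub> y) | y. y \<in> carrier Q}"

definition quasinilpotent :: "('a, 'b) monoid_scheme \<Rightarrow> bool" where
  "quasinilpotent G \<longleftrightarrow> group G \<and> finite (carrier G) \<and>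
     (\<forall>H K. chief_factor G H K \<longrightarrow>
        (\<forall>x\<in>carrier G. conj_factor G H K x \<in> inner_auto (factor G H K)))"

definition maximal_quasinilpotent_subgroup :: "'a set \<Rightarrow> ('a, 'b) monoid_scheme \<Rightarrow> bool" where
  "maximal_quasinilpotent_subgroup M G \<longleftrightarrow>
     subgroup M G \<and> quasinilpotent (G\<lparr>carrier := M\<rparr>) \<and>
     (\<nexists>L. subgroup L G \<and> quasinilpotent (G\<lparr>carrier := L\<rparr>) \<and> M \<subset> L)"

definition centralizer_factor :: "('a, 'b) monoid_scheme \<Rightarrow> 'a set \<Rightarrow> 'a set \<Rightarrow> 'a set" where
  "centralizer_factor G H K =
     {g \<in> carrier G. \<forall>X\<in>carrier (factor G H K). conj_factor G H K g X = X}"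

(* All members of a coset of the centralizer induce the same map; the_elem picks it. *)
definition coset_action ::
    "('a, 'b) monoid_scheme \<Rightarrow> 'a set \<Rightarrow> 'a set \<Rightarrow> 'a set \<Rightarrow> 'a set \<Rightarrow> 'a set" where
  "coset_action G H K c = the_elem (conj_factor G H K ` c)"

(* N is the normal factor and A acts on it from the left through act. *)
definition semidirect_product ::
    "('n, 'b) monoid_scheme \<Rightarrow> ('h, 'c) monoid_scheme \<Rightarrow> ('h \<Rightarrow> 'n \<Rightarrow> 'n) \<Rightarrow> ('n \<times> 'h) monoid" where
  "semidirect_product N A act =
     \<lparr>carrier = carrier N \<times> carrier A,
      mult = (\<lambda>(n, a) (n', a'). (n \<otimes>\<^bsub>N\<^esub> act a n', a \<otimes>\<^bsub>A\<^esub> a')),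
      one = (\<one>\<^bsub>N\<^esub>, \<one>\<^bsub>A\<^esub>)\<rparr>"

(* A class of groups is a predicate. It is only needed at the type of the semidirect products
   that are tested for membership. *)
definition central_factor ::
    "(('a set \<times> 'a set) monoid \<Rightarrow> bool) \<Rightarrow> ('a, 'b) monoid_scheme \<Rightarrow> 'a set \<Rightarrow> 'a set \<Rightarrow> bool" where
  "central_factor \<X> G H K \<longleftrightarrow>
     \<X> (semidirect_product (factor G H K) (G Mod centralizer_factor G H K) (coset_action G H K))"

definition hypercentral ::
    "(('a set \<times> 'a set) monoid \<Rightarrow> bool) \<Rightarrow> ('a, 'b) monoid_scheme \<Rightarrow> 'a set \<Rightarrow> bool" where
  "hypercentral \<X> G N \<longleftrightarrow> N \<lhd> G \<and>
     (N = {\<one>\<^bsub>G\<^esub>} \<or>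
      N \<noteq> {\<one>\<^bsub>G\<^esub>} \<and> (\<forall>H K. chief_factor G H K \<and> H \<subseteq> N \<longrightarrow> central_factor \<X> G H K))"

(* The product of a family of normal subgroups is the subgroup consisting of all finite products
   of elements of its members; see generate_Union_normal below. *)
definition hypercenter ::
    "(('a set \<times> 'a set) monoid \<Rightarrow> bool) \<Rightarrow> ('a, 'b) monoid_scheme \<Rightarrow> 'a set" where
  "hypercenter \<X> G = generate G (\<Union>{N. hypercentral \<X> G N})"


lemma (in group) foldr_set_mult_normal:
  assumes "\<And>N. N \<in> set Ns \<Longrightarrow> N \<lhd> G"
  shows "foldr (<#>) Ns {\<one>} \<lhd> G"
  using assms by (induction Ns) (auto simp: one_is_normal intro!: normal_subgroup_set_mult_closed)

lemma (in group) generate_Union_normal: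
  assumes "\<And>N. N \<in> set Ns \<Longrightarrow> N \<lhd> G"
  shows "generate G (\<Union>(set Ns)) = foldr (<#>) Ns {\<one>}"
proof
  have "N \<subseteq> foldr (<#>) Ns {\<one>}" if "N \<in> set Ns" for N
    using assms that
  proof (induction Ns)
    case (Cons M Ns)
    have M: "M \<lhd> G" and F: "foldr (<#>) Ns {\<one>} \<lhd> G"
      using Cons.prems foldr_set_mult_normal by auto
    have F1: "\<one> \<in> foldr (<#>) Ns {\<one>}"
      using F by (simp add: normal_imp_subgroup subgroup.one_closed)
    show ?case
    proof
      fix y assume y: "y \<in> N"
      have yc: "y \<in> carrier G"
        using y Cons.prems by (meson normal_imp_subgroup subgroup.mem_carrier)
      show "y \<in> foldr (<#>) (M # Ns) {\<one>}"
      proof (cases "N = M")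
        case True
        then have "y \<otimes> \<one> \<in> M <#> foldr (<#>) Ns {\<one>}"
          using y F1 unfolding set_mult_def by blast
        then show ?thesis using yc by simp
      next
        case False
        then have "y \<in> foldr (<#>) Ns {\<one>}" using Cons y by auto
        moreover have "\<one> \<in> M" using M by (simp add: normal_imp_subgroup subgroup.one_closed)
        ultimately have "\<one> \<otimes> y \<in> M <#> foldr (<#>) Ns {\<one>}"
          unfolding set_mult_def by blast
        then show ?thesis using yc by simp
      qed
    qed
  qed simp
  then show "generate G (\<Union>(set Ns)) \<subseteq> foldr (<#>) Ns {\<one>}"
    using foldr_set_mult_normal[OF assms]
    by (intro generate_subgroup_incl normal_imp_subgroup) auto
next
  show "foldr (<#>) Ns {\<one>} \<subseteq> generate G (\<Union>(set Ns))"
  proof (induction Ns)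
    case (Cons N Ns)
    have "generate G (\<Union>(set Ns)) \<subseteq> generate G (\<Union>(set (N # Ns)))"
      by (rule mono_generate) auto
    then show ?case
      using Cons by (auto simp: set_mult_def intro!: generate.eng intro: generate.incl)
  qed (simp add: generate.one)
qed

lemma (in group) conj_factor_coset:
  assumes H: "H \<lhd> G" and K: "K \<lhd> G" and g: "g \<in> carrier G" and h: "h \<in> H"
  shows "conj_factor G H K g (K #> h) = K #> (g \<otimes> h \<otimes> inv g)"
proof -
  have Hc: "h \<in> carrier G" using H h by (meson normal_imp_subgroup subgroup.mem_carrier)
  have Kc: "K \<subseteq> carrier G" using K by (simp add: normal_imp_subgroup subgroup.subset)
  have mem: "K #> h \<in> carrier (factor G H K)"
    using h by (auto simp: FactGroup_def RCOSETS_def r_coset_def)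
  have "(g <# (K #> h)) #> inv g = ((g <# K) #> h) #> inv g"
    using coset_assoc[OF g Hc Kc] by simp
  also have "\<dots> = ((K #> g) #> h) #> inv g"
    using normal.coset_eq[OF K] g by simp
  also have "\<dots> = K #> (g \<otimes> h \<otimes> inv g)"
    using Kc g Hc by (simp add: coset_mult_assoc)
  finally show ?thesis using mem by (simp add: conj_factor_def)
qed

lemma (in group) conj_factor_mult:
  assumes H: "H \<lhd> G" and K: "K \<lhd> G" and g: "g \<in> carrier G" "g' \<in> carrier G"
    and X: "X \<in> carrier (factor G H K)"
  shows "conj_factor G H K (g \<otimes> g') X = conj_factor G H K g (conj_factor G H K g' X)"
proof -
  obtain h where h: "h \<in> H" "X = K #> h"
    using X by (auto simp: FactGroup_def RCOSETS_def r_coset_def)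
  have hc: "h \<in> carrier G" using H h by (meson normal_imp_subgroup subgroup.mem_carrier)
  have "g' \<otimes> h \<otimes> inv g' \<in> H" using H g h by (auto intro: normal.inv_op_closed2)
  then show ?thesis
    using H K g h hc by (simp add: conj_factor_coset inv_mult_group m_assoc)
qed

lemma (in group) coset_action_eq:
  assumes H: "H \<lhd> G" and K: "K \<lhd> G" and g: "g \<in> carrier G"
  shows "coset_action G H K (centralizer_factor G H K #> g) = conj_factor G H K g"
proof -
  have eq: "conj_factor G H K (c \<otimes> g) = conj_factor G H K g"
    if c: "c \<in> centralizer_factor G H K" for c
  proof
    fix X
    show "conj_factor G H K (c \<otimes> g) X = conj_factor G H K g X"
    proof (cases "X \<in> carrier (factor G H K)")
      case True
      then obtain h where h: "h \<in> H" "X = K #> h"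
        by (auto simp: FactGroup_def RCOSETS_def r_coset_def)
      have "g \<otimes> h \<otimes> inv g \<in> H" using H g h by (auto intro: normal.inv_op_closed2)
      then have "conj_factor G H K g X \<in> carrier (factor G H K)"
        using conj_factor_coset[OF H K g h(1)] h
        by (auto simp: FactGroup_def RCOSETS_def r_coset_def)
      then show ?thesis
        using c g H K True by (simp add: conj_factor_mult centralizer_factor_def)
    qed (simp add: conj_factor_def)
  qed
  have "\<one> \<in> centralizer_factor G H K"
  proof -
    have "conj_factor G H K \<one> X = X" if "X \<in> carrier (factor G H K)" for X
    proof -
      obtain h where h: "h \<in> H" "X = K #> h"
        using \<open>X \<in> _\<close> by (auto simp: FactGroup_def RCOSETS_def r_coset_def)
      then have "h \<in> carrier G" using H by (meson normal_imp_subgroup subgroup.mem_carrier)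
      then show ?thesis using conj_factor_coset[OF H K _ h(1), of \<one>] h by simp
    qed
    then show ?thesis by (simp add: centralizer_factor_def)
  qed
  then have "conj_factor G H K ` (centralizer_factor G H K #> g) = {conj_factor G H K g}"
    using eq unfolding r_coset_def by (auto simp: image_iff)
  then show ?thesis by (simp add: coset_action_def)
qed

end

theory Submission
  imports Defs "HOL-Algebra.Sylow" "HOL-Algebra.Group_Action" "HOL-Algebra.Multiplicative_Group"
begin

text \<open>
  A chief factor \<open>H/K\<close> of \<open>G\<close> is \<open>N\<^sup>*\<close>-central iff every element of \<open>G\<close> induces an inner automorphism
  on \<open>H/K\<close>; then \<open>H/K\<close> is simple and stays a chief factor of every subgroup containing \<open>H\<close>.
  Hence \<open>M N\<close> is quasinilpotent for \<open>M\<close> quasinilpotent and \<open>N\<close> normal and hypercentral, so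
  that \<open>N\<close> lies in every maximal quasinilpotent subgroup.

  Conversely let \<open>H/K\<close> be a chief factor below the intersection \<open>D\<close>. As cyclic groups are
  quasinilpotent, every \<open>g\<close> lies in a quasinilpotent subgroup \<open>M\<close> that contains \<open>D\<close>. If \<open>H/K\<close> is
  nonabelian, it is the direct product of minimal normal subgroups of \<open>M/K\<close>, on each of which \<open>g\<close> acts as an
  inner automorphism. If \<open>H/K\<close> is an elementary abelian \<open>p\<close>-group, then \<open>M\<close> centralizes all its chief
  factors in \<open>H/K\<close>, so elements of order prime to \<open>p\<close> centralize \<open>H/K\<close>; thus \<open>G\<close> acts on it as a
  \<open>p\<close>-group, which has a nontrivial fixed point, and the action is trivial by irreducibility.
\<close>

section \<open>Normal sections and inner action\<close>

context group
begin

text \<open>The obstacle is that a chief factor of a subgroup \<open>X\<close> need not be one of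
  \<open>G\<close>, and that it need not lie on either side of a given normal subgroup. Sections of
  all subgroups are therefore kept inside \<open>G\<close>, as pairs of subgroups invariant under
  \<open>X\<close>, and \<open>inner_on_chief_extension\<close> plays the part of the Jordan-Hoelder
  theorem: it is enough to look at the chief factors of \<open>X\<close> below a normal subgroup and
  at those above it. The criterion for central factors holds because inner action means
  \<open>G = HC\<close>, with \<open>C\<close> the centralizer of \<open>H/K\<close>. Then
  \<open>G/C\<close> is an image of the simple group \<open>H/K\<close>, so the semidirect product
  has chief length at most two, with inner action on each factor. In the converse direction the
  abelian case is harder: \<open>M\<close> is only known to centralize its own chief factors inside
  \<open>H/K\<close>, so a single \<open>M\<close> cannot show that \<open>g\<close> acts trivially
  on \<open>H/K\<close>. This is why elements of order prime to \<open>p\<close> are treated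
  separately and why the last step uses all of \<open>G\<close>.\<close>

lemma mult_inv_cancel:
  assumes "x \<in> carrier G" "y \<in> carrier G"
  shows "x \<otimes> (inv x \<otimes> y) = y" "inv x \<otimes> (x \<otimes> y) = y"
  using assms by (simp_all flip: m_assoc)

lemmas group_word_simps = m_assoc inv_mult_group mult_inv_cancel

definition comm :: "'a \<Rightarrow> 'a \<Rightarrow> 'a" where
  "comm x y = x \<otimes> y \<otimes> inv x \<otimes> inv y"

text \<open>\<open>X\<close> stays a mere set of elements of \<open>G\<close>, so that statements
  about different subgroups share one group operation. \<open>quasinilpotent_subgroup_iff\<close>
  translates back to the restricted group.\<close>

definition normal_in :: "'a set \<Rightarrow> 'a set \<Rightarrow> bool" where
  "normal_in X H \<longleftrightarrow> subgroup H G \<and> H \<subseteq> X \<and> (\<forall>x\<in>X. \<forall>h\<in>H. x \<otimes> h \<otimes> inv x \<in> H)"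

definition chief_in :: "'a set \<Rightarrow> 'a set \<Rightarrow> 'a set \<Rightarrow> bool" where
  "chief_in X H K \<longleftrightarrow> normal_in X H \<and> normal_in X K \<and> K \<subset> H \<and>
     (\<nexists>L. normal_in X L \<and> K \<subset> L \<and> L \<subset> H)"

text \<open>Conjugation by \<open>x\<close> and by \<open>h\<close> agree on \<open>H/K\<close> iff
  \<open>inv h \<otimes> x\<close> centralizes \<open>H/K\<close>; in terms of commutators this
  needs no quotient group. See \<open>conj_factor_eq_iff\<close>.\<close>

definition inner_on :: "'a set \<Rightarrow> 'a set \<Rightarrow> 'a set \<Rightarrow> bool" where
  "inner_on X H K \<longleftrightarrow> (\<forall>x\<in>X. \<exists>h\<in>H. \<forall>y\<in>H. comm (inv h \<otimes> x) y \<in> K)"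

definition quasi_in :: "'a set \<Rightarrow> bool" where
  "quasi_in X \<longleftrightarrow> (\<forall>H K. chief_in X H K \<longrightarrow> inner_on X H K)"

section \<open>Commutator identities\<close>

lemma comm_closed [simp]: "x \<in> carrier G \<Longrightarrow> y \<in> carrier G \<Longrightarrow> comm x y \<in> carrier G"
  by (simp add: comm_def)

lemma comm_one [simp]: "x \<in> carrier G \<Longrightarrow> comm x \<one> = \<one>" "x \<in> carrier G \<Longrightarrow> comm \<one> x = \<one>"
  by (simp_all add: comm_def)

lemma conj_eq_comm: "x \<in> carrier G \<Longrightarrow> y \<in> carrier G \<Longrightarrow> x \<otimes> y \<otimes> inv x = comm x y \<otimes> y"
  by (simp add: comm_def group_word_simps)

lemma comm_mult_right:
  assumes "x \<in> carrier G" "y \<in> carrier G" "z \<in> carrier G"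
  shows "comm x (y \<otimes> z) = comm x y \<otimes> (y \<otimes> comm x z \<otimes> inv y)"
  using assms by (simp add: comm_def group_word_simps)

lemma comm_mult_left:
  assumes "x \<in> carrier G" "y \<in> carrier G" "z \<in> carrier G"
  shows "comm (x \<otimes> y) z = (x \<otimes> comm y z \<otimes> inv x) \<otimes> comm x z"
  using assms by (simp add: comm_def group_word_simps)

lemma comm_inv_left:
  assumes "x \<in> carrier G" "y \<in> carrier G"
  shows "comm (inv x) y = inv x \<otimes> inv (comm x y) \<otimes> inv (inv x)"
  using assms by (simp add: comm_def group_word_simps)

lemma inv_comm:
  assumes "x \<in> carrier G" "y \<in> carrier G"
  shows "inv (comm x y) = comm y x"
  using assms by (simp add: comm_def group_word_simps)

lemma comm_conj:
  assumes "g \<in> carrier G" "x \<in> carrier G" "y \<in> carrier G"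
  shows "comm (g \<otimes> x \<otimes> inv g) y = g \<otimes> comm x (inv g \<otimes> y \<otimes> inv (inv g)) \<otimes> inv g"
  using assms by (simp add: comm_def group_word_simps)

section \<open>Subgroups normal relative to \<open>X\<close>, their products and
  centralizers\<close>

lemma normal_inD:
  assumes "normal_in X H"
  shows "subgroup H G" "H \<subseteq> X" "H \<subseteq> carrier G" "\<one> \<in> H"
    and "x \<in> H \<Longrightarrow> y \<in> H \<Longrightarrow> x \<otimes> y \<in> H" "x \<in> H \<Longrightarrow> inv x \<in> H"
    and "g \<in> X \<Longrightarrow> x \<in> H \<Longrightarrow> g \<otimes> x \<otimes> inv g \<in> H"
proof -
  show H: "subgroup H G" and "H \<subseteq> X" using assms by (simp_all add: normal_in_def)
  show "H \<subseteq> carrier G" "\<one> \<in> H"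
    "x \<in> H \<Longrightarrow> y \<in> H \<Longrightarrow> x \<otimes> y \<in> H" "x \<in> H \<Longrightarrow> inv x \<in> H"
    by (fact subgroup.subset[OF H] subgroup.one_closed[OF H]
        subgroup.m_closed[OF H] subgroup.m_inv_closed[OF H])+
  show "g \<in> X \<Longrightarrow> x \<in> H \<Longrightarrow> g \<otimes> x \<otimes> inv g \<in> H" using assms by (simp add: normal_in_def)
qed

lemma normal_in_comm:
  assumes "normal_in X H" "X \<subseteq> carrier G" "x \<in> X" "y \<in> H"
  shows "comm x y \<in> H" "comm y x \<in> H"
proof -
  show "comm x y \<in> H" using assms normal_inD[OF assms(1)] by (simp add: comm_def)
  then have "inv (comm x y) \<in> H" using normal_inD[OF assms(1)] by blast
  moreover have "x \<in> carrier G" "y \<in> carrier G" using assms normal_inD(3)[OF assms(1)] by auto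
  ultimately show "comm y x \<in> H" by (simp add: inv_comm)
qed

lemma normal_in_carrier_iff: "normal_in (carrier G) H \<longleftrightarrow> H \<lhd> G"
  unfolding normal_in_def normal_inv_iff using subgroup.subset by blast

lemma normal_in_Int:
  assumes "normal_in X A" "normal_in X B"
  shows "normal_in X (A \<inter> B)"
  using assms unfolding normal_in_def by (auto intro: subgroups_Inter_pair)

lemma normal_in_mono:
  assumes "normal_in X H" "Y \<subseteq> X" "H \<subseteq> Y"
  shows "normal_in Y H"
  using assms unfolding normal_in_def by auto

lemma normal_in_self:
  assumes "subgroup X G" shows "normal_in X X"
  unfolding normal_in_def
  using assms subgroup.m_closed[OF assms] subgroup.m_inv_closed[OF assms] by simp

lemma normal_in_one:
  assumes "subgroup X G" shows "normal_in X {\<one>}"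
  unfolding normal_in_def
  using subgroup.one_closed[OF assms] subgroup.mem_carrier[OF assms] by (simp add: triv_subgroup)

lemma subgroup_set_mult:
  assumes A: "subgroup A G" and B: "subgroup B G"
    and conj: "\<And>a b. a \<in> A \<Longrightarrow> b \<in> B \<Longrightarrow> a \<otimes> b \<otimes> inv a \<in> B"
  shows "subgroup (A <#> B) G"
proof (rule subgroupI)
  note s = subgroup.mem_carrier[OF A] subgroup.mem_carrier[OF B]
    subgroup.m_closed[OF A] subgroup.m_closed[OF B]
    subgroup.m_inv_closed[OF A] subgroup.m_inv_closed[OF B]
  show "A <#> B \<subseteq> carrier G" using s by (auto simp: set_mult_def)
  show "A <#> B \<noteq> {}"
    using subgroup.one_closed[OF A] subgroup.one_closed[OF B] by (auto simp: set_mult_def)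
  show "inv x \<in> A <#> B" if x: "x \<in> A <#> B" for x
  proof -
    obtain a b where ab: "a \<in> A" "b \<in> B" "x = a \<otimes> b" using x by (auto simp: set_mult_def)
    have "inv x = inv a \<otimes> (a \<otimes> inv b \<otimes> inv a)"
      using ab s by (simp add: group_word_simps)
    moreover have "a \<otimes> inv b \<otimes> inv a \<in> B" using conj[OF ab(1) s(6)[OF ab(2)]] .
    ultimately show ?thesis using s(5)[OF ab(1)] unfolding set_mult_def by blast
  qed
  show "x \<otimes> y \<in> A <#> B" if x: "x \<in> A <#> B" and y: "y \<in> A <#> B" for x y
  proof -
    obtain a b where ab: "a \<in> A" "b \<in> B" "x = a \<otimes> b" using x by (auto simp: set_mult_def)
    obtain c d where cd: "c \<in> A" "d \<in> B" "y = c \<otimes> d" using y by (auto simp: set_mult_def)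
    have "x \<otimes> y = (a \<otimes> c) \<otimes> ((inv c \<otimes> b \<otimes> inv (inv c)) \<otimes> d)"
      using ab cd s by (simp add: group_word_simps)
    moreover have "inv c \<otimes> b \<otimes> inv (inv c) \<in> B" using conj[OF s(5)[OF cd(1)] ab(2)] .
    then have "inv c \<otimes> b \<otimes> inv (inv c) \<otimes> d \<in> B" using s(4) cd(2) by blast
    moreover have "a \<otimes> c \<in> A" using s(3) ab(1) cd(1) by blast
    ultimately show ?thesis unfolding set_mult_def by blast
  qed
qed

lemma subset_set_mult:
  assumes "subgroup A G" "subgroup B G"
  shows "A \<subseteq> A <#> B" "B \<subseteq> A <#> B"
proof -
  have "a \<otimes> \<one> \<in> A <#> B" if "a \<in> A" for a
    using that assms subgroup.one_closed unfolding set_mult_def by blast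
  then show "A \<subseteq> A <#> B" using subgroup.mem_carrier[OF assms(1)] by fastforce
  have "\<one> \<otimes> b \<in> A <#> B" if "b \<in> B" for b
    using that assms subgroup.one_closed unfolding set_mult_def by blast
  then show "B \<subseteq> A <#> B" using subgroup.mem_carrier[OF assms(2)] by fastforce
qed

lemma set_mult_subset:
  assumes "subgroup L G" "A \<subseteq> L" "B \<subseteq> L"
  shows "A <#> B \<subseteq> L"
  using assms subgroup.m_closed[OF assms(1)] by (auto simp: set_mult_def)

lemma normal_in_set_mult:
  assumes sX: "subgroup X G" and A: "normal_in X A" and B: "normal_in X B"
  shows "normal_in X (A <#> B)"
  unfolding normal_in_def
proof (intro conjI ballI)
  note X = subgroup.subset[OF sX]
  show "subgroup (A <#> B) G"
    using A B by (intro subgroup_set_mult) (auto simp: normal_in_def)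
  show "A <#> B \<subseteq> X"
    using set_mult_subset[OF sX] normal_inD(2)[OF A] normal_inD(2)[OF B] by blast
  fix x y assume x: "x \<in> X" and "y \<in> A <#> B"
  then obtain a b where ab: "a \<in> A" "b \<in> B" "y = a \<otimes> b" by (auto simp: set_mult_def)
  have c: "x \<in> carrier G" "a \<in> carrier G" "b \<in> carrier G"
    using x X ab normal_inD(3)[OF A] normal_inD(3)[OF B] by auto
  have "x \<otimes> y \<otimes> inv x = (x \<otimes> a \<otimes> inv x) \<otimes> (x \<otimes> b \<otimes> inv x)"
    using c ab by (simp add: group_word_simps)
  then show "x \<otimes> y \<otimes> inv x \<in> A <#> B"
    using normal_inD(7)[OF A x ab(1)] normal_inD(7)[OF B x ab(2)] unfolding set_mult_def by blast
qed


text \<open>Commutators of products, inverses and conjugates are products of conjugates of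
  commutators or their inverses, and \<open>K\<close> absorbs conjugation by \<open>X\<close>.
  \<open>T\<close> may be any invariant set, because it is instantiated not only with normal
  subgroups but also with a union of conjugates.\<close>

lemma normal_in_centralizer:
  assumes sX: "subgroup X G" and A: "normal_in X A" and K: "normal_in X K"
    and T: "T \<subseteq> X" "\<And>x t. x \<in> X \<Longrightarrow> t \<in> T \<Longrightarrow> x \<otimes> t \<otimes> inv x \<in> T"
  shows "normal_in X {a \<in> A. \<forall>t\<in>T. comm a t \<in> K}" (is "normal_in X ?C")
proof -
  note X = subgroup.mem_carrier[OF sX]
  have Ac: "a \<in> carrier G" "a \<in> X" if "a \<in> A" for a
    using that normal_inD(2,3)[OF A] by auto
  have Tc: "t \<in> carrier G" if "t \<in> T" for t using that T X by auto
  have "subgroup ?C G"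
  proof (rule subgroupI)
    show "?C \<subseteq> carrier G" using Ac by auto
    have "\<one> \<in> ?C" using normal_inD(4)[OF A] normal_inD(4)[OF K] Tc by simp
    then show "?C \<noteq> {}" by blast
  next
    fix a assume a: "a \<in> ?C"
    have "comm (inv a) t \<in> K" if t: "t \<in> T" for t
    proof -
      have "inv (comm a t) \<in> K" using a t normal_inD(6)[OF K] by blast
      then have "inv a \<otimes> inv (comm a t) \<otimes> inv (inv a) \<in> K"
        using normal_inD(7)[OF K] Ac[of a] subgroup.m_inv_closed[OF sX] a by blast
      then show ?thesis using comm_inv_left[of a t] Ac[of a] a Tc[OF t] by simp
    qed
    then show "inv a \<in> ?C" using a normal_inD(6)[OF A] by blast
  next
    fix a b assume ab: "a \<in> ?C" "b \<in> ?C"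
    have "comm (a \<otimes> b) t \<in> K" if t: "t \<in> T" for t
    proof -
      have "(a \<otimes> comm b t \<otimes> inv a) \<otimes> comm a t \<in> K"
        using ab t normal_inD(5,7)[OF K] Ac by blast
      then show ?thesis using comm_mult_left[of a b t] Ac ab Tc[OF t] by simp
    qed
    then show "a \<otimes> b \<in> ?C" using ab normal_inD(5)[OF A] by blast
  qed
  moreover have "x \<otimes> a \<otimes> inv x \<in> ?C" if x: "x \<in> X" and a: "a \<in> ?C" for x a
  proof -
    have "comm (x \<otimes> a \<otimes> inv x) t \<in> K" if t: "t \<in> T" for t
    proof -
      have "inv x \<otimes> t \<otimes> inv (inv x) \<in> T"
        using T(2)[OF subgroup.m_inv_closed[OF sX x] t] .
      then have "x \<otimes> comm a (inv x \<otimes> t \<otimes> inv (inv x)) \<otimes> inv x \<in> K"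
        using a normal_inD(7)[OF K x] by blast
      then show ?thesis using comm_conj[of x a t] Ac a Tc[OF t] X[OF x] by simp
    qed
    then show ?thesis using a normal_inD(7)[OF A x] by blast
  qed
  ultimately show ?thesis using Ac unfolding normal_in_def by blast
qed

section \<open>Chief factors relative to \<open>X\<close>\<close>

lemma chief_in_cases:
  assumes "chief_in X H K" "normal_in X L" "K \<subseteq> L" "L \<subseteq> H"
  shows "L = K \<or> L = H"
  using assms unfolding chief_in_def by blast

lemma ex_chief_in:
  assumes fin: "finite H" and H: "normal_in X H" and K: "normal_in X K" and less: "K \<subset> H"
  shows "\<exists>L\<subseteq>H. chief_in X L K"
proof -
  let ?S = "{L. normal_in X L \<and> K \<subset> L \<and> L \<subseteq> H}"
  have "finite ?S" by (rule finite_subset[of _ "Pow H"]) (auto simp: fin)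
  moreover have "H \<in> ?S" using H less by auto
  ultimately have "\<exists>L\<in>?S. \<forall>B\<in>?S. B \<subseteq> L \<longrightarrow> L = B"
    by (intro finite_has_minimal) (assumption, metis empty_iff)
  then obtain L where L: "L \<in> ?S" "\<forall>B\<in>?S. B \<subseteq> L \<longrightarrow> L = B" by (elim bexE)
  have "chief_in X L K" unfolding chief_in_def
  proof (intro conjI notI)
    assume "\<exists>B. normal_in X B \<and> K \<subset> B \<and> B \<subset> L"
    then obtain B where B: "normal_in X B" "K \<subset> B" "B \<subset> L" by blast
    then have "B \<in> ?S" using L(1) by auto
    then show False using L(2) B(3) by blast
  qed (use L K in auto)
  then show ?thesis using L by blast
qed

text \<open>As a group acted on by \<open>X\<close>, the section \<open>H/K\<close> is isomorphic to
  \<open>(H \<inter> N)/(K \<inter> N)\<close> if \<open>H\<close> lies in \<open>KN\<close>, and to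
  \<open>HN/KN\<close> otherwise; inner action carries over along either isomorphism. The bound
  \<open>T\<close> lets the lemma climb one chief factor at a time.\<close>

lemma inner_on_chief_extension:
  assumes sX: "subgroup X G" and N: "normal_in X N" and T: "normal_in X T" and NT: "N \<subseteq> T"
    and below: "\<And>H K. chief_in X H K \<Longrightarrow> H \<subseteq> N \<Longrightarrow> inner_on X H K"
    and above: "\<And>H K. chief_in X H K \<Longrightarrow> N \<subseteq> K \<Longrightarrow> H \<subseteq> T \<Longrightarrow> inner_on X H K"
    and chief: "chief_in X H K" and HT: "H \<subseteq> T"
  shows "inner_on X H K"
proof -
  have H: "normal_in X H" and K: "normal_in X K" and KH: "K \<subset> H"
    using chief by (auto simp: chief_in_def)
  note X = subgroup.mem_carrier[OF sX]
  have XG: "X \<subseteq> carrier G" using X by blast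
  have sN: "subgroup N G" and sK: "subgroup K G" and sH: "subgroup H G"
    using N K H by (auto simp: normal_in_def)
  have Hc: "x \<in> carrier G" "x \<in> X" if "x \<in> H" for x using that normal_inD(2,3)[OF H] by auto
  have Nc: "x \<in> carrier G" "x \<in> X" if "x \<in> N" for x using that normal_inD(2,3)[OF N] by auto
  have Kc: "x \<in> carrier G" "x \<in> X" if "x \<in> K" for x using that normal_inD(2,3)[OF K] by auto
  let ?R = "K <#> N"
  have R: "normal_in X ?R" using normal_in_set_mult[OF sX K N] .
  have KR: "K \<subseteq> ?R" and NR: "N \<subseteq> ?R" using subset_set_mult[OF sK sN] .
  have RH: "normal_in X (?R \<inter> H)" using normal_in_Int[OF R H] .
  consider "?R \<inter> H = H" | "?R \<inter> H = K"
    using chief_in_cases[OF chief RH] KR KH by blast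
  then show ?thesis
  proof cases
    case 1
    \<comment> \<open>The Dedekind law: \<open>H\<close> is the product of \<open>K\<close> and
      \<open>H \<inter> N\<close>.\<close>
    have dec: "\<exists>k\<in>K. \<exists>y\<in>H \<inter> N. x = k \<otimes> y" if x: "x \<in> H" for x
    proof -
      obtain k y where ky: "k \<in> K" "y \<in> N" "x = k \<otimes> y"
        using x 1 unfolding set_mult_def by blast
      have "inv k \<otimes> x \<in> H" using KH ky normal_inD(5,6)[OF H] x by blast
      moreover have "inv k \<otimes> x = y" using ky Kc Nc by (simp add: group_word_simps)
      ultimately show ?thesis using ky by blast
    qed
    have c: "chief_in X (H \<inter> N) (K \<inter> N)" unfolding chief_in_def
    proof (intro conjI notI)
      show "normal_in X (H \<inter> N)" "normal_in X (K \<inter> N)" using normal_in_Int H K N by auto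
      show "K \<inter> N \<subset> H \<inter> N"
      proof
        show "K \<inter> N \<noteq> H \<inter> N"
        proof
          assume "K \<inter> N = H \<inter> N"
          then have "H \<subseteq> K" using dec normal_inD(5)[OF K] by blast
          then show False using KH by blast
        qed
      qed (use KH in blast)
      \<comment> \<open>\<open>KL\<close> is then strictly between \<open>K\<close> and
        \<open>H\<close>: since \<open>K \<inter> N\<close> lies in \<open>L\<close>, an element of
        \<open>KL\<close> that belongs to \<open>N\<close> is already in \<open>L\<close>.\<close>
      assume "\<exists>L. normal_in X L \<and> K \<inter> N \<subset> L \<and> L \<subset> H \<inter> N"
      then obtain L where L: "normal_in X L" "K \<inter> N \<subset> L" "L \<subset> H \<inter> N" by blast
      have sL: "subgroup L G" using L by (auto simp: normal_in_def)
      have n: "normal_in X (K <#> L)" using normal_in_set_mult[OF sX K L(1)] .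
      have i: "K \<subseteq> K <#> L" "L \<subseteq> K <#> L" using subset_set_mult[OF sK sL] .
      have "K <#> L \<subseteq> H" using set_mult_subset[OF sH] KH L by blast
      then consider "K <#> L = K" | "K <#> L = H" using chief_in_cases[OF chief n i(1)] by blast
      then show False
      proof cases
        case 1
        then show ?thesis using i L by blast
      next
        case 2
        have "x \<in> L" if x: "x \<in> H \<inter> N" for x
        proof -
          obtain k l where kl: "k \<in> K" "l \<in> L" "x = k \<otimes> l"
            using x 2 unfolding set_mult_def by blast
          have lN: "l \<in> N" using L kl by blast
          have "x \<otimes> inv l \<in> N" using x lN normal_inD(5,6)[OF N] by blast
          moreover have "x \<otimes> inv l = k" using kl Kc Nc lN by (simp add: group_word_simps)
          ultimately have "k \<in> L" using kl L by blast
          then show ?thesis using kl normal_inD(5)[OF L(1)] by blast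
        qed
        then show ?thesis using L by blast
      qed
    qed
    then have inn: "inner_on X (H \<inter> N) (K \<inter> N)" using below by blast
    show ?thesis unfolding inner_on_def
    proof
      fix x assume x: "x \<in> X"
      then obtain h where h: "h \<in> H \<inter> N" "\<forall>y\<in>H \<inter> N. comm (inv h \<otimes> x) y \<in> K \<inter> N"
        using inn unfolding inner_on_def by blast
      let ?c = "inv h \<otimes> x"
      have "inv h \<in> X" using h(1) Hc(2) subgroup.m_inv_closed[OF sX] by blast
      then have cX: "?c \<in> X" using x subgroup.m_closed[OF sX] by blast
      have "comm ?c z \<in> K" if z: "z \<in> H" for z
      proof -
        obtain k y where ky: "k \<in> K" "y \<in> H \<inter> N" "z = k \<otimes> y" using dec[OF z] by blast
        have "comm ?c z = comm ?c k \<otimes> (k \<otimes> comm ?c y \<otimes> inv k)"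
          using ky cX X Kc Nc comm_mult_right by blast
        moreover have "comm ?c k \<in> K" using normal_in_comm(1)[OF K XG cX ky(1)] .
        moreover have "k \<otimes> comm ?c y \<otimes> inv k \<in> K"
          using h(2) ky normal_inD(5,6)[OF K] by blast
        ultimately show ?thesis using normal_inD(5)[OF K] by simp
      qed
      then show "\<exists>h\<in>H. \<forall>y\<in>H. comm (inv h \<otimes> x) y \<in> K" using h by blast
    qed
  next
    case 2
    let ?P = "H <#> N"
    have P: "normal_in X ?P" using normal_in_set_mult[OF sX H N] .
    have HP: "H \<subseteq> ?P" and NP: "N \<subseteq> ?P" using subset_set_mult[OF sH sN] .
    have sP: "subgroup ?P G" and sR: "subgroup ?R G" using P R by (auto simp: normal_in_def)
    have c: "chief_in X ?P ?R" unfolding chief_in_def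
    proof (intro conjI notI)
      show "normal_in X ?P" "normal_in X ?R" by fact+
      have "\<not> ?P \<subseteq> ?R" using HP 2 KH by blast
      moreover have "?R \<subseteq> ?P" using set_mult_subset[OF sP] HP NP KH by blast
      ultimately show "?R \<subset> ?P" by blast
      assume "\<exists>L. normal_in X L \<and> ?R \<subset> L \<and> L \<subset> ?P"
      then obtain L where L: "normal_in X L" "?R \<subset> L" "L \<subset> ?P" by blast
      have dec: "\<exists>h\<in>L \<inter> H. \<exists>n\<in>N. x = h \<otimes> n" if x: "x \<in> L" for x
      proof -
        obtain h n where hn: "h \<in> H" "n \<in> N" "x = h \<otimes> n" using x L unfolding set_mult_def by blast
        have "x \<otimes> inv n \<in> L" using x hn NR L normal_inD(5,6)[OF L(1)] by blast
        moreover have "x \<otimes> inv n = h" using hn Hc Nc by (simp add: group_word_simps)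
        ultimately show ?thesis using hn by blast
      qed
      consider "L \<inter> H = K" | "L \<inter> H = H"
        using chief_in_cases[OF chief normal_in_Int[OF L(1) H]] KH KR L by blast
      then show False
      proof cases
        case 1
        then have "L \<subseteq> ?R" using dec unfolding set_mult_def by blast
        then show ?thesis using L by blast
      next
        case 2
        then have "?P \<subseteq> L" using set_mult_subset[of L H N] L NR normal_inD(1)[OF L(1)] by blast
        then show ?thesis using L by blast
      qed
    qed
    have "?P \<subseteq> T" using set_mult_subset[OF normal_inD(1)[OF T] HT NT] .
    then have inn: "inner_on X ?P ?R" using above[OF c NR] by blast
    show ?thesis unfolding inner_on_def
    proof
      fix x assume x: "x \<in> X"
      then obtain p where p: "p \<in> ?P" "\<forall>y\<in>?P. comm (inv p \<otimes> x) y \<in> ?R"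
        using inn unfolding inner_on_def by blast
      then obtain h n where hn: "h \<in> H" "n \<in> N" "p = h \<otimes> n" unfolding set_mult_def by blast
      let ?c = "inv p \<otimes> x"
      have car: "h \<in> carrier G" "n \<in> carrier G" "x \<in> carrier G" "p \<in> carrier G"
        using hn Hc Nc x X by auto
      \<comment> \<open>The witness \<open>p\<close> only lies in \<open>HN\<close>. Its factor
        \<open>n\<close> centralizes \<open>H\<close> modulo \<open>N\<close>, so \<open>h\<close>
        alone works modulo \<open>KN\<close>; the commutators lie in \<open>H\<close>, and
        \<open>KN \<inter> H = K\<close>.\<close>
      have hx: "inv h \<otimes> x = n \<otimes> ?c" using hn car by (simp add: group_word_simps)
      have "inv h \<in> X" using hn(1) Hc(2) subgroup.m_inv_closed[OF sX] by blast
      then have hX: "inv h \<otimes> x \<in> X" using x subgroup.m_closed[OF sX] by blast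
      have "comm (inv h \<otimes> x) z \<in> K" if z: "z \<in> H" for z
      proof -
        have zP: "z \<in> ?P" using z HP by blast
        have "comm (inv h \<otimes> x) z = (n \<otimes> comm ?c z \<otimes> inv n) \<otimes> comm n z"
          unfolding hx using car Hc[OF z] by (intro comm_mult_left) auto
        moreover have "n \<otimes> comm ?c z \<otimes> inv n \<in> ?R"
          using p(2) zP hn(2) Nc normal_inD(7)[OF R] by blast
        moreover have "comm n z \<in> ?R" using normal_in_comm(2)[OF N XG Hc(2)[OF z] hn(2)] NR by blast
        ultimately have "comm (inv h \<otimes> x) z \<in> ?R" using normal_inD(5)[OF R] by simp
        moreover have "comm (inv h \<otimes> x) z \<in> H" using normal_in_comm(1)[OF H XG hX z] .
        ultimately show ?thesis using 2 by blast
      qed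
      then show "\<exists>h\<in>H. \<forall>y\<in>H. comm (inv h \<otimes> x) y \<in> K" using hn by blast
    qed
  qed
qed

end

section \<open>Subgroups generated by a hypercentral subgroup\<close>

context group
begin

text \<open>Takes the place of induction along a chief series: a largest subgroup with the desired
  property is enlarged by one chief factor unless it is everything. It also supplies maximal
  quasinilpotent subgroups.\<close>

lemma ex_maximal_set:
  assumes "finite U" "A \<subseteq> U" "P A" "\<And>B. P B \<Longrightarrow> B \<subseteq> U"
  shows "\<exists>B. P B \<and> A \<subseteq> B \<and> (\<forall>C. P C \<longrightarrow> B \<subseteq> C \<longrightarrow> C = B)"
proof -
  have "finite (Collect P)" using assms(1,4) by (auto intro: rev_finite_subset[of "Pow U"])
  moreover have "A \<in> Collect P" using assms by simp
  ultimately have "\<exists>m\<in>Collect P. A \<subseteq> m \<and> (\<forall>b\<in>Collect P. m \<subseteq> b \<longrightarrow> m = b)"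
    by (rule finite_has_maximal2)
  then show ?thesis by auto
qed

text \<open>Modulo \<open>K\<close>, elements of \<open>G\<close> move \<open>H\<close> as elements
  of \<open>H\<close> do. Hence a subgroup between \<open>K\<close> and \<open>H\<close> that is
  normal in \<open>X\<close>, and so invariant under \<open>H\<close>, is invariant under all of
  \<open>G\<close>.\<close>

lemma chief_in_subgroup:
  assumes chief: "chief_in (carrier G) H K" and inn: "inner_on (carrier G) H K"
    and X: "subgroup X G" and HX: "H \<subseteq> X"
  shows "chief_in X H K" "inner_on X H K"
proof -
  have XG: "X \<subseteq> carrier G" using subgroup.subset[OF X] .
  have H: "normal_in (carrier G) H" and K: "normal_in (carrier G) K" and KH: "K \<subset> H"
    using chief by (auto simp: chief_in_def)
  show "inner_on X H K" using inn XG unfolding inner_on_def by blast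
  have "L = K \<or> L = H" if L: "normal_in X L" "K \<subseteq> L" "L \<subseteq> H" for L
  proof -
    have "g \<otimes> l \<otimes> inv g \<in> L" if g: "g \<in> carrier G" and l: "l \<in> L" for g l
    proof -
      obtain h where h: "h \<in> H" "\<forall>y\<in>H. comm (inv h \<otimes> g) y \<in> K"
        using inn g unfolding inner_on_def by blast
      have car: "h \<in> carrier G" "l \<in> carrier G" "h \<in> X"
        using h(1) l L normal_inD(3)[OF H] HX by auto
      let ?c = "inv h \<otimes> g"
      have "comm ?c l \<otimes> l \<in> L" using h(2) l L normal_inD(5)[OF L(1)] by blast
      then have "?c \<otimes> l \<otimes> inv ?c \<in> L" using conj_eq_comm[of ?c l] car g by simp
      then have "h \<otimes> (?c \<otimes> l \<otimes> inv ?c) \<otimes> inv h \<in> L" using normal_inD(7)[OF L(1) car(3)] by blast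
      moreover have "h \<otimes> (?c \<otimes> l \<otimes> inv ?c) \<otimes> inv h = g \<otimes> l \<otimes> inv g"
        using car g by (simp add: group_word_simps)
      ultimately show ?thesis by simp
    qed
    then have "normal_in (carrier G) L"
      using L normal_inD(1,3)[OF L(1)] unfolding normal_in_def by blast
    then show ?thesis using chief_in_cases[OF chief] L by blast
  qed
  moreover have "normal_in X H" "normal_in X K"
    using normal_in_mono[OF H XG HX] normal_in_mono[OF K XG] HX KH by auto
  ultimately show "chief_in X H K" using KH unfolding chief_in_def by blast
qed

text \<open>A chief factor of \<open>X\<close> below \<open>N\<close> need not be one of
  \<open>G\<close>. But a chief series of \<open>G\<close> up to \<open>N\<close> consists of chief
  factors of \<open>X\<close> with inner action, by \<open>chief_in_subgroup\<close>, and
  \<open>inner_on_chief_extension\<close> passes from it to arbitrary chief factors of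
  \<open>X\<close>. \<open>R\<close> is the highest term of such a series for which this is
  known.\<close>

lemma inner_on_below_normal:
  assumes fin: "finite (carrier G)" and N: "normal_in (carrier G) N"
    and inn: "\<And>H K. chief_in (carrier G) H K \<Longrightarrow> H \<subseteq> N \<Longrightarrow> inner_on (carrier G) H K"
    and X: "subgroup X G" and NX: "N \<subseteq> X"
    and chief: "chief_in X H K" and HN: "H \<subseteq> N"
  shows "inner_on X H K"
proof -
  have XG: "X \<subseteq> carrier G" using subgroup.subset[OF X] .
  define P where "P R \<longleftrightarrow> normal_in (carrier G) R \<and> R \<subseteq> N \<and>
    (\<forall>H K. chief_in X H K \<longrightarrow> H \<subseteq> R \<longrightarrow> inner_on X H K)" for R
  have "P {\<one>}"
  proof -
    have False if "chief_in X H K" "H \<subseteq> {\<one>}" for H K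
      using that normal_inD(4)[of X K] unfolding chief_in_def by blast
    then show ?thesis unfolding P_def
      using normal_in_one[OF subgroup_self] normal_inD(4)[OF N] by blast
  qed
  then have "\<exists>R. P R \<and> {\<one>} \<subseteq> R \<and> (\<forall>C. P C \<longrightarrow> R \<subseteq> C \<longrightarrow> C = R)"
    using fin by (intro ex_maximal_set[of "carrier G"]) (auto simp: P_def normal_in_def)
  then obtain R where R: "P R" "\<forall>C. P C \<longrightarrow> R \<subseteq> C \<longrightarrow> C = R" by blast
  have RG: "normal_in (carrier G) R" and RN: "R \<subseteq> N" using R(1) by (auto simp: P_def)
  have "R = N"
  proof (rule ccontr)
    assume "R \<noteq> N"
    then have "R \<subset> N" using RN by blast
    moreover have "finite N" using finite_subset[OF normal_inD(3)[OF N] fin] .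
    ultimately obtain L where L: "L \<subseteq> N" "chief_in (carrier G) L R"
      using ex_chief_in[OF _ N RG] by blast
    have LX: "L \<subseteq> X" using L NX by blast
    note c = chief_in_subgroup[OF L(2) inn[OF L(2,1)] X LX]
    have LG: "normal_in (carrier G) L" and RL: "R \<subset> L" using L(2) by (auto simp: chief_in_def)
    have "inner_on X A B" if AB: "chief_in X A B" "A \<subseteq> L" for A B
    proof (rule inner_on_chief_extension[OF X _ _ _ _ _ AB, of R])
      show "normal_in X R" "normal_in X L" "R \<subseteq> L" using c unfolding chief_in_def by auto
      show "inner_on X H K" if "chief_in X H K" "H \<subseteq> R" for H K
        using that R(1) by (auto simp: P_def)
      show "inner_on X H K" if HK: "chief_in X H K" "R \<subseteq> K" "H \<subseteq> L" for H K
      proof -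
        have n: "normal_in X H" "normal_in X K" "K \<subset> H" using HK(1) by (auto simp: chief_in_def)
        have "K = R" using chief_in_cases[OF c(1) n(2)] HK n by blast
        moreover have "H = L" using chief_in_cases[OF c(1) n(1)] HK n by blast
        ultimately show ?thesis using c(2) by simp
      qed
    qed
    then have "P L" using LG L(1) by (auto simp: P_def)
    then show False using R(2) RL by blast
  qed
  then show ?thesis using R(1) chief HN by (auto simp: P_def)
qed

text \<open>Below \<open>N\<close> the previous lemma applies. Above \<open>N\<close>, intersecting
  with \<open>M\<close> turns a chief factor \<open>A/B\<close> of \<open>MN\<close> into an
  isomorphic one of \<open>M\<close>, and \<open>N\<close> acts trivially on \<open>A/B\<close>, so
  that the inner action of \<open>M\<close> suffices.\<close>

lemma quasi_in_set_mult:
  assumes fin: "finite (carrier G)" and N: "normal_in (carrier G) N"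
    and inn: "\<And>H K. chief_in (carrier G) H K \<Longrightarrow> H \<subseteq> N \<Longrightarrow> inner_on (carrier G) H K"
    and M: "subgroup M G" and qM: "quasi_in M"
  shows "subgroup (M <#> N) G" "quasi_in (M <#> N)"
proof -
  let ?X = "M <#> N"
  note Mc = subgroup.mem_carrier[OF M]
  have Nc: "x \<in> carrier G" if "x \<in> N" for x using that normal_inD(3)[OF N] by blast
  have sN: "subgroup N G" using N by (simp add: normal_in_def)
  show X: "subgroup ?X G"
    using subgroup_set_mult[OF M sN] normal_inD(7)[OF N] Mc by blast
  have XG: "?X \<subseteq> carrier G" using subgroup.subset[OF X] .
  have MX: "M \<subseteq> ?X" and NX: "N \<subseteq> ?X" using subset_set_mult[OF M sN] .
  have NnX: "normal_in ?X N" using normal_in_mono[OF N XG NX] .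
  have "inner_on ?X A B" if AB: "chief_in ?X A B" and NB: "N \<subseteq> B" for A B
  proof -
    have A: "normal_in ?X A" and B: "normal_in ?X B" and BA: "B \<subset> A"
      using AB by (auto simp: chief_in_def)
    have NA: "N \<subseteq> A" using NB BA by blast
    have Ac: "x \<in> carrier G" "x \<in> ?X" if "x \<in> A" for x using that normal_inD(2,3)[OF A] by auto
    have Bc: "x \<in> carrier G" if "x \<in> B" for x using that normal_inD(3)[OF B] by auto
    have dec: "\<exists>m\<in>R \<inter> M. \<exists>n\<in>N. a = m \<otimes> n"
      if R: "normal_in ?X R" "N \<subseteq> R" and a: "a \<in> R" for a R
    proof -
      obtain m n where mn: "m \<in> M" "n \<in> N" "a = m \<otimes> n"
        using a normal_inD(2)[OF R(1)] unfolding set_mult_def by blast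
      have "a \<otimes> inv n \<in> R" using a mn R normal_inD(5,6)[OF R(1)] by blast
      moreover have "a \<otimes> inv n = m" using mn Mc Nc by (simp add: group_word_simps)
      ultimately show ?thesis using mn by blast
    qed
    have nM: "normal_in M (R \<inter> M)" if R: "normal_in ?X R" for R
      unfolding normal_in_def
    proof (intro conjI ballI)
      show "subgroup (R \<inter> M) G" using subgroups_Inter_pair[OF normal_inD(1)[OF R] M] .
      fix x h assume x: "x \<in> M" "h \<in> R \<inter> M"
      then have "x \<otimes> h \<otimes> inv x \<in> R" using normal_inD(7)[OF R] MX by blast
      moreover have "x \<otimes> h \<otimes> inv x \<in> M"
        using x subgroup.m_closed[OF M] subgroup.m_inv_closed[OF M] by blast
      ultimately show "x \<otimes> h \<otimes> inv x \<in> R \<inter> M" by blast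
    qed blast
    have "chief_in M (A \<inter> M) (B \<inter> M)" unfolding chief_in_def
    proof (intro conjI notI)
      show "normal_in M (A \<inter> M)" "normal_in M (B \<inter> M)" using nM A B by auto
      show "B \<inter> M \<subset> A \<inter> M"
      proof
        show "B \<inter> M \<noteq> A \<inter> M"
        proof
          assume eq: "B \<inter> M = A \<inter> M"
          have "a \<in> B" if a: "a \<in> A" for a
            using dec[OF A NA a] eq NB normal_inD(5)[OF B] by blast
          then show False using BA by blast
        qed
      qed (use BA in blast)
      assume "\<exists>L. normal_in M L \<and> B \<inter> M \<subset> L \<and> L \<subset> A \<inter> M"
      then obtain L where L: "normal_in M L" "B \<inter> M \<subset> L" "L \<subset> A \<inter> M" by blast
      have sL: "subgroup L G" using L by (simp add: normal_in_def)
      have Lc: "l \<in> carrier G" if "l \<in> L" for l using that L Mc by blast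
      let ?Y = "L <#> N"
      have sY: "subgroup ?Y G"
        using subgroup_set_mult[OF sL sN] normal_inD(7)[OF N] Lc by blast
      have LY: "L \<subseteq> ?Y" and NY: "N \<subseteq> ?Y" using subset_set_mult[OF sL sN] .
      have YA: "?Y \<subseteq> A" using set_mult_subset[OF normal_inD(1)[OF A]] L NA by blast
      have "normal_in ?X ?Y" unfolding normal_in_def
      proof (intro conjI ballI)
        show "?Y \<subseteq> ?X" using YA Ac(2) by blast
        fix x y assume "x \<in> ?X" "y \<in> ?Y"
        then obtain m n l k where e: "m \<in> M" "n \<in> N" "x = m \<otimes> n" "l \<in> L" "k \<in> N" "y = l \<otimes> k"
          unfolding set_mult_def by blast
        have car: "m \<in> carrier G" "n \<in> carrier G" "l \<in> carrier G" "k \<in> carrier G"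
          using e Mc Nc Lc by auto
        \<comment> \<open>Moving \<open>n\<close> past \<open>l\<close> in the conjugate of
          \<open>l \<otimes> k\<close> by \<open>m \<otimes> n\<close> leaves the conjugate of
          \<open>l\<close> by \<open>m\<close>, in \<open>L\<close>, times the conjugate by
          \<open>m\<close> of this element of \<open>N\<close>.\<close>
        let ?u = "inv l \<otimes> n \<otimes> inv (inv l) \<otimes> k \<otimes> inv n"
        have "inv l \<otimes> n \<otimes> inv (inv l) \<in> N" using normal_inD(7)[OF N _ e(2), of "inv l"] car by simp
        then have "?u \<in> N" using e normal_inD(5,6)[OF N] by blast
        then have "m \<otimes> ?u \<otimes> inv m \<in> N" using normal_inD(7)[OF N car(1)] by blast
        moreover have "m \<otimes> l \<otimes> inv m \<in> L" using normal_inD(7)[OF L(1) e(1,4)] .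
        moreover have "x \<otimes> y \<otimes> inv x = (m \<otimes> l \<otimes> inv m) \<otimes> (m \<otimes> ?u \<otimes> inv m)"
          using car e by (simp add: group_word_simps)
        ultimately show "x \<otimes> y \<otimes> inv x \<in> ?Y" unfolding set_mult_def by blast
      qed (rule sY)
      moreover have "B \<subseteq> ?Y"
      proof
        fix b assume "b \<in> B"
        then obtain m n where "m \<in> B \<inter> M" "n \<in> N" "b = m \<otimes> n" using dec[OF B NB] by blast
        then show "b \<in> ?Y" using L unfolding set_mult_def by blast
      qed
      ultimately consider "?Y = B" | "?Y = A" using chief_in_cases[OF AB] YA by blast
      then show False
      proof cases
        case 1
        then show ?thesis using LY L by blast
      next
        case 2
        have "a \<in> L" if a: "a \<in> A \<inter> M" for a
        proof -
          obtain l n where ln: "l \<in> L" "n \<in> N" "a = l \<otimes> n"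
            using a 2 unfolding set_mult_def by blast
          have lM: "l \<in> M" using ln L by blast
          have "inv l \<otimes> a \<in> M"
            using a lM subgroup.m_closed[OF M] subgroup.m_inv_closed[OF M] by blast
          moreover have "inv l \<otimes> a = n" using ln Lc Nc by (simp add: group_word_simps)
          ultimately have "n \<in> L" using ln NB L by blast
          then show ?thesis using ln normal_inD(5)[OF L(1)] by blast
        qed
        then show ?thesis using L by blast
      qed
    qed
    then have iM: "inner_on M (A \<inter> M) (B \<inter> M)" using qM by (auto simp: quasi_in_def)
    show ?thesis unfolding inner_on_def
    proof
      fix x assume x: "x \<in> ?X"
      then obtain m n where mn: "m \<in> M" "n \<in> N" "x = m \<otimes> n" unfolding set_mult_def by blast
      obtain h where h: "h \<in> A \<inter> M" "\<forall>y\<in>A \<inter> M. comm (inv h \<otimes> m) y \<in> B \<inter> M"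
        using iM mn(1) unfolding inner_on_def by blast
      let ?c = "inv h \<otimes> m"
      have cM: "?c \<in> M"
        using mn h subgroup.m_closed[OF M] subgroup.m_inv_closed[OF M] by blast
      have car: "h \<in> carrier G" "m \<in> carrier G" "n \<in> carrier G" "?c \<in> carrier G" "?c \<in> ?X"
        using h mn Mc Nc cM MX by auto
      have "comm (inv h \<otimes> x) z \<in> B" if z: "z \<in> A" for z
      proof -
        obtain y k where yk: "y \<in> A \<inter> M" "k \<in> N" "z = y \<otimes> k" using dec[OF A NA z] by blast
        have yc: "y \<in> carrier G" "k \<in> carrier G" "y \<in> ?X" using yk Ac Nc by auto
        have "comm ?c z = comm ?c y \<otimes> (y \<otimes> comm ?c k \<otimes> inv y)"
          unfolding yk(3) using comm_mult_right[OF car(4) yc(1,2)] .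
        moreover have "comm ?c k \<in> B"
          using normal_in_comm(1)[OF NnX XG car(5) yk(2)] NB by blast
        ultimately have 1: "comm ?c z \<in> B"
          using h(2) yk(1) yc(3) normal_inD(5,7)[OF B] by (metis IntD1)
        \<comment> \<open>The part \<open>n\<close> of \<open>x\<close> centralizes \<open>A\<close>
          modulo \<open>N\<close>, so the witness found for \<open>m\<close> also serves
          \<open>x\<close>.\<close>
        have "comm n z \<in> B" using normal_in_comm(2)[OF NnX XG Ac(2)[OF z] mn(2)] NB by blast
        then have "(?c \<otimes> comm n z \<otimes> inv ?c) \<otimes> comm ?c z \<in> B"
          using 1 normal_inD(5,7)[OF B] car by blast
        moreover have "comm (?c \<otimes> n) z = (?c \<otimes> comm n z \<otimes> inv ?c) \<otimes> comm ?c z"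
          using comm_mult_left[OF car(4,3) Ac(1)[OF z]] .
        moreover have "inv h \<otimes> x = ?c \<otimes> n" using mn car by (simp add: group_word_simps)
        ultimately show ?thesis by simp
      qed
      then show "\<exists>h\<in>A. \<forall>y\<in>A. comm (inv h \<otimes> x) y \<in> B" using h(1) by blast
    qed
  qed
  then have "inner_on ?X A B" if "chief_in ?X A B" for A B
    using inner_on_chief_extension[OF X NnX normal_in_self[OF X] NX
        inner_on_below_normal[OF fin N inn X NX] _ that]
      that normal_inD(2)[of ?X A] by (auto simp: chief_in_def)
  then show "quasi_in ?X" by (simp add: quasi_in_def)
qed

lemma quasi_in_abelian:
  assumes X: "subgroup X G" and ab: "\<And>x y. x \<in> X \<Longrightarrow> y \<in> X \<Longrightarrow> comm x y = \<one>"
  shows "quasi_in X"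
  unfolding quasi_in_def inner_on_def
proof (intro allI impI ballI)
  fix H K x assume "chief_in X H K" and x: "x \<in> X"
  then have H: "normal_in X H" and K: "normal_in X K" by (auto simp: chief_in_def)
  have "comm (inv \<one> \<otimes> x) y \<in> K" if "y \<in> H" for y
    using ab[of x y] x that normal_inD(2)[OF H] normal_inD(4)[OF K] subgroup.mem_carrier[OF X x] by auto
  then show "\<exists>h\<in>H. \<forall>y\<in>H. comm (inv h \<otimes> x) y \<in> K" using normal_inD(4)[OF H] by blast
qed

section \<open>Invariance of quasinilpotency under conjugation\<close>

definition conj_by :: "'a \<Rightarrow> 'a \<Rightarrow> 'a" where
  "conj_by g x = g \<otimes> x \<otimes> inv g"

lemma conj_by_hom: "g \<in> carrier G \<Longrightarrow> group_hom G G (conj_by g)"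
  by (intro group_hom.intro group_hom_axioms.intro is_group)
    (simp add: hom_def conj_by_def group_word_simps)

lemma conj_by_inverse:
  assumes "g \<in> carrier G" "A \<subseteq> carrier G"
  shows "conj_by (inv g) ` conj_by g ` A = A"
proof -
  have "conj_by (inv g) (conj_by g x) = x" if "x \<in> A" for x
    using that assms by (auto simp: conj_by_def group_word_simps)
  then show ?thesis by (auto simp: image_image)
qed

lemma conj_by_inj:
  assumes "g \<in> carrier G" "A \<subseteq> carrier G"
  shows "inj_on (conj_by g) A"
proof (rule inj_onI)
  fix x y assume "x \<in> A" "y \<in> A" "conj_by g x = conj_by g y"
  then show "x = y" using assms conjugation_is_inj[of g x y] by (auto simp: conj_by_def)
qed

lemma conj_by_comm:
  assumes "g \<in> carrier G" "x \<in> carrier G" "y \<in> carrier G"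
  shows "comm (conj_by g x) (conj_by g y) = conj_by g (comm x y)"
  using assms by (simp add: comm_def conj_by_def group_word_simps)

lemma subgroup_conj_by:
  assumes "g \<in> carrier G" "subgroup H G"
  shows "subgroup (conj_by g ` H) G"
  using group_hom.subgroup_img_is_subgroup[OF conj_by_hom[OF assms(1)] assms(2)] .

lemma normal_in_conj_by:
  assumes g: "g \<in> carrier G" and X: "X \<subseteq> carrier G" and H: "normal_in X H"
  shows "normal_in (conj_by g ` X) (conj_by g ` H)"
  unfolding normal_in_def
proof (intro conjI ballI)
  show "subgroup (conj_by g ` H) G" using subgroup_conj_by[OF g normal_inD(1)[OF H]] .
  show "conj_by g ` H \<subseteq> conj_by g ` X" using normal_inD(2)[OF H] by blast
  fix x' h' assume "x' \<in> conj_by g ` X" "h' \<in> conj_by g ` H"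
  then obtain x h where e: "x \<in> X" "h \<in> H" "x' = conj_by g x" "h' = conj_by g h" by blast
  have "x \<in> carrier G" "h \<in> carrier G" using e X normal_inD(3)[OF H] by auto
  then have "x' \<otimes> h' \<otimes> inv x' = conj_by g (x \<otimes> h \<otimes> inv x)"
    using g e by (simp add: conj_by_def group_word_simps)
  then show "x' \<otimes> h' \<otimes> inv x' \<in> conj_by g ` H" using normal_inD(7)[OF H e(1,2)] by blast
qed

lemma chief_in_conj_by:
  assumes g: "g \<in> carrier G" and X: "X \<subseteq> carrier G" and c: "chief_in X H K"
  shows "chief_in (conj_by g ` X) (conj_by g ` H) (conj_by g ` K)"
proof -
  have H: "normal_in X H" and K: "normal_in X K" and KH: "K \<subset> H"
    using c by (auto simp: chief_in_def)
  have Hc: "H \<subseteq> carrier G" and Kc: "K \<subseteq> carrier G" using normal_inD(3) H K by auto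
  have ig: "inv g \<in> carrier G" using g by simp
  have cX: "conj_by g ` X \<subseteq> carrier G" using g X by (auto simp: conj_by_def)
  have cH: "conj_by g ` H \<subseteq> carrier G" using g Hc by (auto simp: conj_by_def)
  have min: "\<not> (normal_in (conj_by g ` X) L \<and> conj_by g ` K \<subset> L \<and> L \<subset> conj_by g ` H)" for L
  proof
    assume L: "normal_in (conj_by g ` X) L \<and> conj_by g ` K \<subset> L \<and> L \<subset> conj_by g ` H"
    then have Lc: "L \<subseteq> carrier G" using normal_inD(3) by blast
    have "normal_in X (conj_by (inv g) ` L)"
      using normal_in_conj_by[OF ig cX, of L] L conj_by_inverse[OF g X] by simp
    moreover have "K \<subset> conj_by (inv g) ` L"
      using image_strict_mono[OF conj_by_inj[OF ig Lc], of "conj_by g ` K"] L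
        conj_by_inverse[OF g Kc] by simp
    moreover have "conj_by (inv g) ` L \<subset> H"
      using image_strict_mono[OF conj_by_inj[OF ig cH], of L] L
        conj_by_inverse[OF g Hc] by simp
    ultimately show False using c unfolding chief_in_def by blast
  qed
  show ?thesis
    unfolding chief_in_def
    by (intro conjI normal_in_conj_by[OF g X] H K image_strict_mono[OF conj_by_inj[OF g Hc] KH])
      (simp add: min)
qed

lemma inner_on_conj_by:
  assumes g: "g \<in> carrier G" and X: "X \<subseteq> carrier G" and H: "H \<subseteq> carrier G"
    and inn: "inner_on X H K"
  shows "inner_on (conj_by g ` X) (conj_by g ` H) (conj_by g ` K)"
  unfolding inner_on_def
proof
  fix x' assume "x' \<in> conj_by g ` X"
  then obtain x where x: "x \<in> X" "x' = conj_by g x" by blast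
  then obtain h where h: "h \<in> H" "\<forall>y\<in>H. comm (inv h \<otimes> x) y \<in> K"
    using inn unfolding inner_on_def by blast
  have car: "x \<in> carrier G" "h \<in> carrier G" using x h X H by auto
  have e: "inv (conj_by g h) \<otimes> x' = conj_by g (inv h \<otimes> x)"
    using car g x by (simp add: conj_by_def group_word_simps)
  have "comm (inv (conj_by g h) \<otimes> x') (conj_by g y) \<in> conj_by g ` K" if y: "y \<in> H" for y
    unfolding e using conj_by_comm[OF g, of "inv h \<otimes> x" y] car y H h(2) by auto
  then show "\<exists>h\<in>conj_by g ` H. \<forall>y\<in>conj_by g ` H. comm (inv h \<otimes> x') y \<in> conj_by g ` K"
    using h(1) by blast
qed

lemma quasi_in_conj_by:
  assumes g: "g \<in> carrier G" and X: "X \<subseteq> carrier G" and q: "quasi_in X"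
  shows "quasi_in (conj_by g ` X)"
  unfolding quasi_in_def
proof (intro allI impI)
  fix H K assume c: "chief_in (conj_by g ` X) H K"
  have ig: "inv g \<in> carrier G" using g by simp
  have cX: "conj_by g ` X \<subseteq> carrier G" using g X by (auto simp: conj_by_def)
  have Hc: "H \<subseteq> carrier G" "K \<subseteq> carrier G" using c normal_inD(3) by (auto simp: chief_in_def)
  have cH: "conj_by (inv g) ` H \<subseteq> carrier G" using g Hc by (auto simp: conj_by_def)
  have cancel: "conj_by g ` conj_by (inv g) ` A = A" if "A \<subseteq> carrier G" for A
    using conj_by_inverse[OF ig that] g by simp
  have "chief_in X (conj_by (inv g) ` H) (conj_by (inv g) ` K)"
    using chief_in_conj_by[OF ig cX c] conj_by_inverse[OF g X] by simp
  then have "inner_on X (conj_by (inv g) ` H) (conj_by (inv g) ` K)"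
    using q by (simp add: quasi_in_def)
  then show "inner_on (conj_by g ` X) H K"
    using inner_on_conj_by[OF g X cH] cancel Hc by force
qed

end

section \<open>Nonabelian chief factors\<close>

context group
begin

lemma conj_by_normal_image:
  assumes "normal_in (carrier G) H" "g \<in> carrier G"
  shows "conj_by g ` H = H"
proof
  show sub: "conj_by g ` H \<subseteq> H"
    using normal_inD(7)[OF assms(1)] assms(2) by (auto simp: conj_by_def)
  have ig: "inv g \<in> carrier G" using assms by simp
  have "conj_by (inv g) ` H \<subseteq> H"
    using normal_inD(7)[OF assms(1) ig] by (auto simp: conj_by_def)
  then have "conj_by g ` conj_by (inv g) ` H \<subseteq> conj_by g ` H" by (rule image_mono)
  then show "H \<subseteq> conj_by g ` H"
    using conj_by_inverse[OF ig normal_inD(3)[OF assms(1)]] assms(2) by simp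
qed

(* Distinct conjugates of a minimal normal subgroup of H/K intersect trivially and hence commute,
   so if they are abelian, they are central in their product, which is H/K. *)
lemma abelian_normal_below_chief_factor:
  assumes fin: "finite (carrier G)" and chief: "chief_in (carrier G) H K"
    and nonab: "a \<in> H" "b \<in> H" "comm a b \<notin> K"
    and L: "normal_in H L" and KL: "K \<subseteq> L"
    and ab: "\<And>x y. x \<in> L \<Longrightarrow> y \<in> L \<Longrightarrow> comm x y \<in> K"
  shows "L = K"
proof (rule ccontr)
  assume "L \<noteq> K"
  then have less: "K \<subset> L" using KL by blast
  have H: "normal_in (carrier G) H" and K: "normal_in (carrier G) K" and KH: "K \<subset> H"
    using chief by (auto simp: chief_in_def)
  have HG: "H \<subseteq> carrier G" using normal_inD(3)[OF H] .
  have sH: "subgroup H G" using normal_inD(1)[OF H] .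
  have KnH: "normal_in H K" using normal_in_mono[OF K HG] KH by blast
  have "finite L" using finite_subset[OF normal_inD(3)[OF L] fin] .
  then obtain B where BL: "B \<subseteq> L" and B: "chief_in H B K"
    using ex_chief_in[OF _ L KnH less] by blast
  have BH: "B \<subseteq> H" and KB: "K \<subset> B" using B normal_inD(2) by (auto simp: chief_in_def)
  have Bg: "chief_in H (conj_by g ` B) K" if "g \<in> carrier G" for g
    using chief_in_conj_by[OF that HG B] conj_by_normal_image that H K by simp
  define T where "T = (\<Union>g\<in>carrier G. conj_by g ` B)"
  have TH: "T \<subseteq> H"
    using conj_by_normal_image[OF H] BH unfolding T_def by blast
  have comT: "comm s t \<in> K" if s: "s \<in> T" and t: "t \<in> T" for s t
  proof -
    obtain g g' where g: "g \<in> carrier G" "s \<in> conj_by g ` B"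
      and g': "g' \<in> carrier G" "t \<in> conj_by g' ` B"
      using s t unfolding T_def by blast
    let ?B1 = "conj_by g ` B" and ?B2 = "conj_by g' ` B"
    have n: "normal_in H ?B1" "normal_in H ?B2" "K \<subseteq> ?B1" "K \<subseteq> ?B2"
      using Bg[OF g(1)] Bg[OF g'(1)] by (auto simp: chief_in_def)
    show ?thesis
    proof (cases "?B1 = ?B2")
      case True
      then have "t \<in> conj_by g ` B" using g'(2) by simp
      then obtain x y where xy: "x \<in> B" "y \<in> B" "s = conj_by g x" "t = conj_by g y"
        using g(2) by (elim imageE)
      then have "x \<in> carrier G" "y \<in> carrier G" using BH HG by auto
      then have "comm s t = conj_by g (comm x y)" using conj_by_comm[OF g(1)] xy by simp
      moreover have "comm x y \<in> K" using ab xy BL by blast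
      ultimately show ?thesis using conj_by_normal_image[OF K g(1)] by blast
    next
      case False
      have i: "normal_in H (?B1 \<inter> ?B2)" using normal_in_Int[OF n(1,2)] .
      have "?B1 \<inter> ?B2 = K \<or> ?B1 \<inter> ?B2 = ?B1" "?B1 \<inter> ?B2 = K \<or> ?B1 \<inter> ?B2 = ?B2"
        using chief_in_cases[OF Bg[OF g(1)] i] chief_in_cases[OF Bg[OF g'(1)] i] n(3,4) by auto
      then have "?B1 \<inter> ?B2 = K" using False by auto
      moreover have "comm s t \<in> ?B1" using normal_in_comm(2)[OF n(1) HG _ g(2)] t TH by blast
      moreover have "comm s t \<in> ?B2" using normal_in_comm(1)[OF n(2) HG _ g'(2)] s TH by blast
      ultimately show ?thesis by blast
    qed
  qed
  have Tconj: "x \<otimes> t \<otimes> inv x \<in> T" if x: "x \<in> carrier G" and t: "t \<in> T" for x t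
  proof -
    obtain g c where g: "g \<in> carrier G" "c \<in> B" "t = conj_by g c" using t unfolding T_def by blast
    have cG: "c \<in> carrier G" using g BH HG by blast
    have "x \<otimes> t \<otimes> inv x = conj_by (x \<otimes> g) c"
      using x g cG by (simp add: conj_by_def group_word_simps)
    then show ?thesis using x g unfolding T_def by blast
  qed
  have BT: "B \<subseteq> T"
  proof
    fix x assume x: "x \<in> B"
    then have "conj_by \<one> x = x" using BH HG by (auto simp: conj_by_def)
    then show "x \<in> T" using x unfolding T_def by force
  qed
  \<comment> \<open>The product of the conjugates is avoided by taking centralizers twice:
    \<open>?W\<close> contains \<open>B\<close> and is normal in \<open>G\<close>, so all of
    \<open>H\<close> commutes with \<open>T\<close> modulo \<open>K\<close>; hence \<open>B\<close>
    is central modulo \<open>K\<close>, and the centre \<open>?Z\<close> is all of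
    \<open>H\<close>.\<close>
  let ?W = "{x \<in> H. \<forall>t\<in>T. comm x t \<in> K}"
  have W: "normal_in (carrier G) ?W"
    using normal_in_centralizer[OF subgroup_self H K _ Tconj] TH HG by blast
  have "K \<subseteq> ?W" using normal_in_comm(2)[OF KnH HG] KH TH by blast
  moreover have "B \<subseteq> ?W" using BH BT comT by blast
  ultimately have WH: "?W = H" using chief_in_cases[OF chief W] KB by blast
  let ?Z = "{x \<in> H. \<forall>t\<in>H. comm x t \<in> K}"
  have Z: "normal_in (carrier G) ?Z"
    using normal_in_centralizer[OF subgroup_self H K HG normal_inD(7)[OF H]] .
  have "B \<subseteq> ?Z"
  proof -
    have "comm x t \<in> K" if "x \<in> B" "t \<in> H" for x t
    proof -
      have "comm t x \<in> K" using that WH BT by blast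
      then have "inv (comm t x) \<in> K" using normal_inD(6)[OF K] by blast
      moreover have "t \<in> carrier G" "x \<in> carrier G" using that BH HG by blast+
      ultimately show ?thesis by (simp add: inv_comm)
    qed
    then show ?thesis using BH by blast
  qed
  moreover have "K \<subseteq> ?Z" using normal_in_comm(2)[OF KnH HG] KH by blast
  ultimately have "?Z = H" using chief_in_cases[OF chief Z] KB by blast
  then show False using nonab by blast
qed

text \<open>The direct decomposition is not constructed. \<open>T\<close> is a largest part of
  \<open>H\<close> on which \<open>M\<close> acts by inner automorphisms, and \<open>?C\<close> is
  its centralizer modulo \<open>K\<close>. A chief factor of \<open>M\<close> inside
  \<open>?C\<close> could be added to \<open>T\<close> as a direct factor. If there is none,
  \<open>?C = K\<close>; each \<open>x\<close> in \<open>H\<close> acts on \<open>T\<close> like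
  some \<open>t\<close>, so \<open>inv t \<otimes> x\<close> is in \<open>K\<close> and
  \<open>T\<close> is all of \<open>H\<close>.\<close>

lemma inner_on_nonabelian_chief_factor_subgroup:
  assumes fin: "finite (carrier G)" and chief: "chief_in (carrier G) H K"
    and nonab: "a \<in> H" "b \<in> H" "comm a b \<notin> K"
    and M: "subgroup M G" and q: "quasi_in M" and HM: "H \<subseteq> M"
  shows "inner_on M H K"
proof -
  have H: "normal_in (carrier G) H" and K: "normal_in (carrier G) K" and KH: "K \<subset> H"
    using chief by (auto simp: chief_in_def)
  have HG: "H \<subseteq> carrier G" using normal_inD(3)[OF H] .
  have MG: "M \<subseteq> carrier G" using subgroup.subset[OF M] .
  have HnM: "normal_in M H" using normal_in_mono[OF H MG HM] .
  have KnM: "normal_in M K" using normal_in_mono[OF K MG] KH HM by blast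
  define P where "P T \<longleftrightarrow> normal_in M T \<and> K \<subseteq> T \<and> T \<subseteq> H \<and> inner_on M T K" for T
  have "P K" unfolding P_def inner_on_def
  proof (intro conjI KnM ballI)
    fix x assume x: "x \<in> M"
    have "comm (inv \<one> \<otimes> x) y \<in> K" if "y \<in> K" for y
      using normal_in_comm(1)[OF KnM MG x that] x MG by auto
    then show "\<exists>h\<in>K. \<forall>y\<in>K. comm (inv h \<otimes> x) y \<in> K" using normal_inD(4)[OF K] by blast
  qed (use KH in auto)
  then have "\<exists>T. P T \<and> K \<subseteq> T \<and> (\<forall>C. P C \<longrightarrow> T \<subseteq> C \<longrightarrow> C = T)"
    using fin HG KH finite_subset[OF HG fin]
    by (intro ex_maximal_set[of H]) (auto simp: P_def)
  then obtain T where "P T" and max: "\<And>C. P C \<Longrightarrow> T \<subseteq> C \<Longrightarrow> C = T" by blast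
  then have T: "normal_in M T" and KT: "K \<subseteq> T" and TH: "T \<subseteq> H" and iT: "inner_on M T K"
    by (auto simp: P_def)
  let ?C = "{x \<in> H. \<forall>t\<in>T. comm x t \<in> K}"
  have C: "normal_in M ?C"
    using normal_in_centralizer[OF M HnM KnM normal_inD(2)[OF T] normal_inD(7)[OF T]] .
  have KC: "K \<subseteq> ?C" using normal_in_comm(2)[OF KnM MG] KH TH HM by blast
  \<comment> \<open>\<open>?C\<close> commutes with \<open>T\<close> modulo \<open>K\<close>, so the
    intersection commutes with itself.\<close>
  have TC: "T \<inter> ?C = K"
  proof (rule abelian_normal_below_chief_factor[OF fin chief nonab])
    show "normal_in H (T \<inter> ?C)"
      using normal_in_mono[OF normal_in_Int[OF T C] HM] TH by blast
    show "K \<subseteq> T \<inter> ?C" using KT KC by blast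
  qed blast
  have "T = H"
  proof (cases "?C = K")
    case True
    have "x \<in> T" if x: "x \<in> H" for x
    proof -
      obtain t where t: "t \<in> T" "\<forall>y\<in>T. comm (inv t \<otimes> x) y \<in> K"
        using iT x HM unfolding inner_on_def by blast
      have "inv t \<otimes> x \<in> H" using t x TH normal_inD(5,6)[OF H] by blast
      then have "inv t \<otimes> x \<in> T" using t(2) True KT by blast
      then have "t \<otimes> (inv t \<otimes> x) \<in> T" using t(1) normal_inD(5)[OF T] by blast
      moreover have "t \<in> carrier G" "x \<in> carrier G" using t x TH HG by auto
      ultimately show ?thesis by (simp add: mult_inv_cancel)
    qed
    then show ?thesis using TH by blast
  next
    case False
    then have KC': "K \<subset> ?C" using KC by blast
    have "finite ?C" using finite_subset[OF normal_inD(3)[OF C] fin] .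
    then obtain L where LC: "L \<subseteq> ?C" and cL: "chief_in M L K"
      using ex_chief_in[OF _ C KnM KC'] by blast
    have iL: "inner_on M L K" using q cL by (simp add: quasi_in_def)
    have L: "normal_in M L" and KL: "K \<subset> L" using cL by (auto simp: chief_in_def)
    have sT: "subgroup T G" and sL: "subgroup L G" using T L by (auto simp: normal_in_def)
    let ?Y = "T <#> L"
    have TY: "T \<subseteq> ?Y" and LY: "L \<subseteq> ?Y" using subset_set_mult[OF sT sL] .
    have "inner_on M ?Y K" unfolding inner_on_def
    proof
      fix x assume x: "x \<in> M"
      obtain t where t: "t \<in> T" "\<forall>y\<in>T. comm (inv t \<otimes> x) y \<in> K"
        using iT x unfolding inner_on_def by blast
      let ?c = "inv t \<otimes> x"
      have tM: "t \<in> M" using t TH HM by blast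
      have cM: "?c \<in> M" using tM x subgroup.m_closed[OF M] subgroup.m_inv_closed[OF M] by blast
      \<comment> \<open>\<open>l\<close> is chosen for \<open>inv t \<otimes> x\<close>, which
        already centralizes \<open>T\<close> modulo \<open>K\<close>. As \<open>L\<close> lies in
        \<open>?C\<close>, the correction by \<open>l\<close> preserves this, and
        \<open>t \<otimes> l\<close> is a common witness for \<open>T\<close> and
        \<open>L\<close>.\<close>
      obtain l where l: "l \<in> L" "\<forall>y\<in>L. comm (inv l \<otimes> ?c) y \<in> K"
        using iL cM unfolding inner_on_def by blast
      let ?d = "inv l \<otimes> ?c"
      have lM: "l \<in> M" using l LC HM by blast
      have ilL: "inv l \<in> L" using l normal_inD(6)[OF L] by blast
      have ilM: "inv l \<in> M" using ilL LC HM by blast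
      have car: "t \<in> carrier G" "x \<in> carrier G" "l \<in> carrier G" "?c \<in> carrier G"
        "inv l \<in> carrier G" "?d \<in> carrier G"
        using tM x lM cM MG by auto
      have e: "inv (t \<otimes> l) \<otimes> x = ?d" using car by (simp add: group_word_simps)
      have "comm (inv (t \<otimes> l) \<otimes> x) y \<in> K" if y: "y \<in> ?Y" for y
      proof -
        obtain t' l' where tl: "t' \<in> T" "l' \<in> L" "y = t' \<otimes> l'"
          using y unfolding set_mult_def by blast
        have tlM: "t' \<in> M" "l' \<in> M" using tl TH LC HM by auto
        have tlc: "t' \<in> carrier G" "l' \<in> carrier G" using tlM MG by auto
        have "comm ?d t' = (inv l \<otimes> comm ?c t' \<otimes> inv (inv l)) \<otimes> comm (inv l) t'"
          using comm_mult_left[OF car(5,4) tlc(1)] .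
        moreover have "inv l \<otimes> comm ?c t' \<otimes> inv (inv l) \<in> K"
          using normal_inD(7)[OF KnM ilM] t(2) tl(1) by blast
        moreover have "comm (inv l) t' \<in> K" using ilL LC tl(1) by blast
        ultimately have "comm ?d t' \<in> K" using normal_inD(5)[OF K] by simp
        moreover have "t' \<otimes> comm ?d l' \<otimes> inv t' \<in> K"
          using normal_inD(7)[OF KnM tlM(1)] l(2) tl(2) by blast
        ultimately show ?thesis
          unfolding e tl(3) using comm_mult_right[OF car(6) tlc] normal_inD(5)[OF K] by simp
      qed
      moreover have "t \<otimes> l \<in> ?Y" using t l unfolding set_mult_def by blast
      ultimately show "\<exists>h\<in>?Y. \<forall>y\<in>?Y. comm (inv h \<otimes> x) y \<in> K" by blast
    qed
    moreover have "?Y \<subseteq> H" using set_mult_subset[OF normal_inD(1)[OF H] TH] LC by blast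
    ultimately have "P ?Y"
      unfolding P_def using normal_in_set_mult[OF M T L] TY KT by blast
    then have "L \<subseteq> T" using max[OF _ TY] LY by simp
    then have "L \<subseteq> T \<inter> ?C" using LC by (rule Int_greatest)
    then have "L \<subseteq> K" unfolding TC .
    then show ?thesis using KL by blast
  qed
  then show ?thesis using iT by simp
qed

end

section \<open>Abelian chief factors\<close>

text \<open>Here \<open>w\<close> is the commutator of \<open>x\<close> and \<open>u\<close>. Since
  \<open>x\<close> commutes with \<open>w\<close>, moving \<open>k\<close> copies of
  \<open>x\<close> past \<open>u\<close> produces \<open>w [^] k\<close>, so the order of
  \<open>w\<close> divides both \<open>n\<close> and \<open>p\<close>. This is the core of coprime
  action: an element of order prime to \<open>p\<close> that acts trivially on two successive
  sections of exponent \<open>p\<close> acts trivially on both together.\<close>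

lemma (in group) commutator_pow_cancel:
  fixes n p :: nat
  assumes car: "x \<in> carrier G" "u \<in> carrier G" "w \<in> carrier G"
    and xu: "x \<otimes> u = w \<otimes> u \<otimes> x" and xw: "x \<otimes> w = w \<otimes> x"
    and n: "x [^] n = \<one>" and p: "w [^] p = \<one>" and cop: "coprime n p"
  shows "w = \<one>"
proof -
  have "x [^] k \<otimes> u = w [^] k \<otimes> u \<otimes> x [^] k" for k :: nat
  proof (induction k)
    case (Suc k)
    have "x [^] Suc k \<otimes> u = x [^] k \<otimes> (x \<otimes> u)" using car by (simp add: m_assoc)
    also have "\<dots> = (x [^] k \<otimes> w) \<otimes> (u \<otimes> x)" using car xu by (simp add: m_assoc)
    also have "\<dots> = (w \<otimes> x [^] k) \<otimes> (u \<otimes> x)" using group_commutes_pow[OF xw] car by simp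
    also have "\<dots> = w \<otimes> (x [^] k \<otimes> u) \<otimes> x" using car by (simp add: m_assoc)
    also have "\<dots> = w \<otimes> (w [^] k \<otimes> u \<otimes> x [^] k) \<otimes> x" using Suc by simp
    also have "\<dots> = (w \<otimes> w [^] k) \<otimes> u \<otimes> x [^] Suc k" using car by (simp add: m_assoc)
    also have "w \<otimes> w [^] k = w [^] Suc k" using car nat_pow_Suc2 by simp
    finally show ?case .
  qed (use car in simp)
  from this[of n] have "w [^] n = \<one>" using n car by (simp add: r_cancel_one')
  then have "ord w dvd n" "ord w dvd p" using p car pow_eq_id by auto
  then have "ord w = 1" using cop by (metis coprime_common_divisor_nat)
  then show ?thesis using car ord_eq_1 by blast
qed

context group_hom
begin

lemma hom_comm_eq_one_iff:
  assumes "x \<in> carrier G" "y \<in> carrier G"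
  shows "h (G.comm x y) = \<one>\<^bsub>H\<^esub> \<longleftrightarrow> h x \<otimes>\<^bsub>H\<^esub> h y = h y \<otimes>\<^bsub>H\<^esub> h x"
proof -
  have "h (G.comm x y) = (h x \<otimes>\<^bsub>H\<^esub> h y) \<otimes>\<^bsub>H\<^esub> inv\<^bsub>H\<^esub> (h y \<otimes>\<^bsub>H\<^esub> h x)"
    using assms by (simp add: G.comm_def H.inv_mult_group H.m_assoc)
  then show ?thesis using assms by (metis H.inv_equality H.inv_inv H.inv_closed H.m_closed H.r_inv hom_closed)
qed

text \<open>Applied below with \<open>h\<close> the projection onto the quotient by
  \<open>K\<close>, where relations modulo \<open>K\<close> become the equations that
  \<open>commutator_pow_cancel\<close> asks for.\<close>

lemma commutator_in_kernel:
  fixes n p :: nat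
  assumes car: "x \<in> carrier G" "u \<in> carrier G"
    and xw: "h (G.comm x (G.comm x u)) = \<one>\<^bsub>H\<^esub>"
    and n: "h (x [^] n) = \<one>\<^bsub>H\<^esub>" and p: "h (G.comm x u [^] p) = \<one>\<^bsub>H\<^esub>" and cop: "coprime n p"
  shows "h (G.comm x u) = \<one>\<^bsub>H\<^esub>"
proof (rule H.commutator_pow_cancel[OF _ _ _ _ _ _ _ cop])
  let ?w = "G.comm x u"
  show "h x \<in> carrier H" "h u \<in> carrier H" "h ?w \<in> carrier H" using car by auto
  have "x \<otimes> u = ?w \<otimes> u \<otimes> x" using car by (simp add: G.comm_def G.group_word_simps)
  then have "h (x \<otimes> u) = h (?w \<otimes> u \<otimes> x)" by simp
  then show "h x \<otimes>\<^bsub>H\<^esub> h u = h ?w \<otimes>\<^bsub>H\<^esub> h u \<otimes>\<^bsub>H\<^esub> h x" using car by simp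
  show "h x \<otimes>\<^bsub>H\<^esub> h ?w = h ?w \<otimes>\<^bsub>H\<^esub> h x" using xw hom_comm_eq_one_iff[of x ?w] car by simp
  show "h x [^]\<^bsub>H\<^esub> n = \<one>\<^bsub>H\<^esub>" using n car hom_nat_pow by simp
  show "h ?w [^]\<^bsub>H\<^esub> p = \<one>\<^bsub>H\<^esub>" using p car hom_nat_pow by simp
qed

lemma pow_mult_in_kernel:
  fixes n :: nat
  assumes "x \<in> carrier G" "y \<in> carrier G" "h (G.comm x y) = \<one>\<^bsub>H\<^esub>"
    and "h (x [^] n) = \<one>\<^bsub>H\<^esub>" "h (y [^] n) = \<one>\<^bsub>H\<^esub>"
  shows "h ((x \<otimes> y) [^] n) = \<one>\<^bsub>H\<^esub>"
  using assms H.pow_mult_distrib[of "h x" "h y" n] hom_comm_eq_one_iff[of x y] by (simp add: hom_nat_pow)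

end

context group
begin

lemma quotient_hom: "normal_in (carrier G) K \<Longrightarrow> group_hom G (G Mod K) (\<lambda>a. K #> a)"
  by (intro group_hom.intro group_hom_axioms.intro is_group normal.factorgroup_is_group
      normal.r_coset_hom_Mod) (simp_all add: normal_in_carrier_iff)

lemma quotient_eq_one_iff:
  assumes "normal_in (carrier G) K" "x \<in> carrier G"
  shows "K #> x = \<one>\<^bsub>G Mod K\<^esub> \<longleftrightarrow> x \<in> K"
  using coset_join1[of K x] coset_join2[of x K] assms normal_inD(1)[OF assms(1)] by auto

lemma commutator_pow_in_normal:
  fixes n p :: nat
  assumes K: "normal_in (carrier G) K" and car: "x \<in> carrier G" "u \<in> carrier G"
    and xw: "comm x (comm x u) \<in> K" and n: "x [^] n = \<one>" and p: "comm x u [^] p \<in> K"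
    and cop: "coprime n p"
  shows "comm x u \<in> K"
proof -
  note e = quotient_eq_one_iff[OF K]
  have "\<one> \<in> K" using normal_inD(4)[OF K] .
  then have "K #> comm x u = \<one>\<^bsub>G Mod K\<^esub>"
    by (intro group_hom.commutator_in_kernel[OF quotient_hom[OF K] car _ _ _ cop])
      (use e xw n p car in auto)
  then show ?thesis using e car by simp
qed

lemma pow_mult_in_normal:
  fixes n :: nat
  assumes K: "normal_in (carrier G) K" and car: "x \<in> carrier G" "y \<in> carrier G"
    and "comm x y \<in> K" "x [^] n \<in> K" "y [^] n \<in> K"
  shows "(x \<otimes> y) [^] n \<in> K"
proof -
  note e = quotient_eq_one_iff[OF K]
  have "K #> ((x \<otimes> y) [^] n) = \<one>\<^bsub>G Mod K\<^esub>"
    by (intro group_hom.pow_mult_in_kernel[OF quotient_hom[OF K] car]) (use e assms in auto)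
  then show ?thesis using e car by simp
qed

lemma conj_pow:
  assumes "g \<in> carrier G" "x \<in> carrier G"
  shows "(g \<otimes> x \<otimes> inv g) [^] (n::nat) = g \<otimes> x [^] n \<otimes> inv g"
  using group_hom.hom_nat_pow[OF conj_by_hom[OF assms(1)] assms(2), of n] by (simp add: conj_by_def)

lemma subgroup_nat_pow_closed:
  assumes "subgroup H G" "x \<in> H"
  shows "x [^] (n::nat) \<in> H"
  using assms by (induction n) (auto simp: subgroup.one_closed subgroup.m_closed)

text \<open>Choose \<open>x\<close> outside \<open>K\<close> with the smallest positive exponent
  \<open>n\<close> that takes any such element into \<open>K\<close>. For a prime divisor
  \<open>p\<close> of \<open>n\<close>, minimality forces \<open>x [^] p\<close> into
  \<open>K\<close>. Modulo \<open>K\<close> the \<open>p\<close>-th power map is multiplicative on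
  \<open>H\<close>, so the elements it kills form a normal subgroup; it contains \<open>x\<close>,
  hence is all of \<open>H\<close>.\<close>

lemma abelian_chief_factor_exponent:
  assumes fin: "finite (carrier G)" and chief: "chief_in (carrier G) H K"
    and ab: "\<And>x y. x \<in> H \<Longrightarrow> y \<in> H \<Longrightarrow> comm x y \<in> K"
  shows "\<exists>p. prime (p::nat) \<and> (\<forall>x\<in>H. x [^] p \<in> K)"
proof -
  have H: "normal_in (carrier G) H" and K: "normal_in (carrier G) K" and KH: "K \<subset> H"
    using chief by (auto simp: chief_in_def)
  have HG: "H \<subseteq> carrier G" using normal_inD(3)[OF H] .
  have sK: "subgroup K G" and sH: "subgroup H G" using normal_inD(1) K H by auto
  define P where "P n \<longleftrightarrow> 0 < n \<and> (\<exists>x\<in>H - K. x [^] n \<in> K)" for n :: nat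
  obtain z where z: "z \<in> H - K" using KH by blast
  have "z \<in> carrier G" using z HG by blast
  then have "z [^] order G \<in> K" using pow_order_eq_1 normal_inD(4)[OF K] by simp
  then have "P (order G)" unfolding P_def using z fin order_gt_0_iff_finite by blast
  then have "P (LEAST n. P n)" by (rule LeastI)
  then obtain n where n: "P n" and least: "\<And>m. P m \<Longrightarrow> n \<le> m" using Least_le by blast
  obtain x where x: "x \<in> H" "x \<notin> K" "x [^] n \<in> K" "0 < n" using n by (auto simp: P_def)
  have xG: "x \<in> carrier G" using x HG by blast
  have "n \<noteq> 1" using x xG by auto
  then obtain p where p: "prime p" "p dvd n" using prime_factor_nat by blast
  then obtain m where m: "n = p * m" by auto
  have "x [^] p \<in> K"
  proof (rule ccontr)
    assume "x [^] p \<notin> K"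
    then have "x [^] p \<in> H - K" using subgroup_nat_pow_closed[OF sH x(1)] by blast
    moreover have "(x [^] p) [^] m \<in> K" using x m nat_pow_pow[OF xG] by simp
    ultimately have "P m" using x(4) m unfolding P_def by auto
    then have "p * m \<le> m" using least m by auto
    moreover have "1 < p" "0 < m" using p prime_gt_1_nat x(4) m by auto
    ultimately show False by simp
  qed
  let ?E = "{y \<in> H. y [^] p \<in> K}"
  have "normal_in (carrier G) ?E" unfolding normal_in_def
  proof (intro conjI ballI)
    show "subgroup ?E G"
    proof (rule subgroupI)
      show "?E \<subseteq> carrier G" using HG by blast
      show "?E \<noteq> {}" using \<open>x [^] p \<in> K\<close> x(1) by blast
    next
      fix y assume y: "y \<in> ?E"
      then have "inv y [^] p = inv (y [^] p)" using HG by (auto intro: nat_pow_inv)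
      then show "inv y \<in> ?E" using y normal_inD(6)[OF H] normal_inD(6)[OF K] by auto
    next
      fix y y' assume y: "y \<in> ?E" "y' \<in> ?E"
      then have "(y \<otimes> y') [^] p \<in> K"
        using pow_mult_in_normal[OF K, of y y' p] ab HG by auto
      then show "y \<otimes> y' \<in> ?E" using y normal_inD(5)[OF H] by auto
    qed
    show "?E \<subseteq> carrier G" using HG by blast
    fix g y assume gy: "g \<in> carrier G" "y \<in> ?E"
    then have "(g \<otimes> y \<otimes> inv g) [^] p \<in> K"
      using conj_pow[of g y p] HG normal_inD(7)[OF K] by auto
    then show "g \<otimes> y \<otimes> inv g \<in> ?E" using gy normal_inD(7)[OF H] by auto
  qed
  moreover have "K \<subseteq> ?E" using KH subgroup_nat_pow_closed[OF sK] by blast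
  moreover have "x \<in> ?E" using x \<open>x [^] p \<in> K\<close> by blast
  ultimately have "?E = H" using chief_in_cases[OF chief, of ?E] x(2) by blast
  then show ?thesis using p(1) by blast
qed

(* Sylow subgroups for the primes other than p are contained in C. *)
lemma prime_power_index:
  fixes p :: nat
  assumes fin: "finite (carrier G)" and C: "subgroup C G" and p: "prime p"
    and in_C: "\<And>x n. x \<in> carrier G \<Longrightarrow> x [^] (n::nat) = \<one> \<Longrightarrow> coprime n p \<Longrightarrow> x \<in> C"
  shows "\<exists>k. order G dvd p ^ k * card C"
proof -
  define a where "a = multiplicity p (order G)"
  have ord: "order G \<noteq> 0" using fin order_gt_0_iff_finite by simp
  obtain m where m: "order G = p ^ a * m" "\<not> p dvd m"
    using multiplicity_decompose'[of "order G" p] ord p a_def by (metis not_prime_unit)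
  have m0: "m \<noteq> 0" using m ord by (metis dvd_0_right)
  \<comment> \<open>\<open>m\<close> is the part of the order prime to \<open>p\<close>, so this
    yields the claim with \<open>k = a\<close>. It is checked one prime \<open>q\<close> at a time;
    \<open>q = p\<close> contributes nothing.\<close>
  have "m dvd card C"
  proof (rule multiplicity_le_imp_dvd[OF m0])
    fix q :: nat assume q: "prime q"
    define b where "b = multiplicity q m"
    have "q ^ b dvd card C"
    proof (cases "q = p")
      case True
      then have "b = 0" using m by (simp add: b_def not_dvd_imp_multiplicity_0)
      then show ?thesis by simp
    next
      case False
      have "q ^ b dvd m" by (simp add: b_def multiplicity_dvd)
      then have "q ^ b dvd order G" using m by simp
      then obtain r where "order G = q ^ b * r" by auto
      then obtain Q where Q: "subgroup Q G" "card Q = q ^ b"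
        using sylow_thm[OF q is_group _ fin] by blast
      have "coprime (q ^ b) p"
        using primes_coprime[OF q p False] by (simp add: coprime_power_left_iff)
      moreover have "x [^] (q ^ b) = \<one>" if x: "x \<in> Q" for x
        using group.pow_order_eq_1[OF subgroup_imp_group[OF Q(1)], of x] x Q(2)
          nat_pow_consistent[of x "q ^ b" Q] by (simp add: order_def)
      ultimately have QC: "Q \<subseteq> C" using in_C subgroup.mem_carrier[OF Q(1)] by blast
      have "subgroup Q (G\<lparr>carrier := C\<rparr>)" using subgroup_incl[OF Q(1) C QC] .
      then have "card Q dvd order (G\<lparr>carrier := C\<rparr>)"
        using group.lagrange[OF subgroup_imp_group[OF C]] by (metis dvd_triv_right)
      then show ?thesis using Q by (simp add: order_def)
    qed
    moreover have "card C \<noteq> 0"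
      using subgroup.one_closed[OF C] finite_subset[OF subgroup.subset[OF C] fin] by auto
    ultimately show "multiplicity q m \<le> multiplicity q (card C)"
      using q b_def by (intro multiplicity_geI) (auto simp: not_prime_unit)
  qed
  then show ?thesis using m by (metis mult_dvd_mono dvd_refl)
qed

end

text \<open>\<open>C\<close> lies in every stabilizer, so orbit lengths divide the index of
  \<open>C\<close>, a power of \<open>p\<close>. Were \<open>e\<close> the only fixed point, every
  orbit but \<open>{e}\<close> would have length divisible by \<open>p\<close>, against
  \<open>p\<close> dividing \<open>card E\<close>. Expressing the index by a divisibility spares
  passing to a quotient group that acts.\<close>

lemma (in group_action) prime_fixed_point:
  fixes p k :: nat
  assumes fin: "finite (carrier G)" "finite E" and p: "prime p" "p dvd card E"
    and C: "subgroup C G" "\<And>c x. c \<in> C \<Longrightarrow> x \<in> E \<Longrightarrow> \<phi> c x = x"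
    and ord: "order G dvd p ^ k * card C"
    and e: "e \<in> E" "\<And>g. g \<in> carrier G \<Longrightarrow> \<phi> g e = e"
  shows "\<exists>x\<in>E. x \<noteq> e \<and> (\<forall>g\<in>carrier G. \<phi> g x = x)"
proof (rule ccontr)
  assume no: "\<not> ?thesis"
  interpret group G using group_hom group_hom.axioms(1) by blast
  have cardC: "card C > 0"
    using subgroup.one_closed[OF C(1)] finite_subset[OF subgroup.subset[OF C(1)] fin(1)]
    by (auto simp: card_gt_0_iff)
  have orb: "p dvd card (orbit G \<phi> x)" if x: "x \<in> E" "x \<noteq> e" for x
  proof -
    let ?S = "stabilizer G \<phi> x"
    have S: "subgroup ?S G" using stabilizer_subgroup[OF x(1)] .
    have "C \<subseteq> ?S" using C x(1) subgroup.subset[OF C(1)] by (auto simp: stabilizer_def)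
    then have "subgroup C (G\<lparr>carrier := ?S\<rparr>)" using subgroup_incl[OF C(1) S] by blast
    then have "card C dvd order (G\<lparr>carrier := ?S\<rparr>)"
      using group.lagrange[OF subgroup_imp_group[OF S]] by (metis dvd_triv_right)
    then have "card C dvd card ?S" by (simp add: order_def)
    then have "card (orbit G \<phi> x) * card C dvd p ^ k * card C"
      using orbit_stabilizer_theorem[OF x(1)] ord by (metis mult_dvd_mono dvd_refl dvd_trans)
    then have "card (orbit G \<phi> x) dvd p ^ k" using cardC by simp
    then obtain i where i: "card (orbit G \<phi> x) = p ^ i"
      using divides_primepow_nat[OF p(1)] by blast
    show ?thesis
    proof (cases i)
      case 0
      then have "card (orbit G \<phi> x) = 1" using i by simp
      then obtain y where y: "orbit G \<phi> x = {y}" by (auto simp: card_1_singleton_iff)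
      then have "y = x" using orbit_refl[OF x(1)] by simp
      then have "\<forall>g\<in>carrier G. \<phi> g x = x" using y unfolding orbit_def by blast
      then show ?thesis using no x by blast
    next
      case (Suc j)
      then show ?thesis using i by simp
    qed
  qed
  let ?O = "{orbit G \<phi> x | x. x \<in> E \<and> x \<noteq> e}"
  have orb_e: "orbit G \<phi> e = {e}" using e(2) orbit_refl[OF e(1)] by (auto simp: orbit_def)
  have orbE: "orbit G \<phi> x \<subseteq> E" if "x \<in> E" for x
    using element_image that by (auto simp: orbit_def)
  have "e \<notin> orbit G \<phi> x" if "x \<in> E" "x \<noteq> e" for x
    using orbit_sym[OF that(1) e(1)] orb_e that(2) by auto
  then have un: "\<Union>?O = E - {e}" using orbE orbit_refl by fastforce
  have "p dvd card (\<Union>?O)"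
  proof (rule dvd_partition)
    show "finite (\<Union>?O)" using un fin by simp
    show "\<forall>c\<in>?O. p dvd card c" using orb by blast
    show "\<forall>c1\<in>?O. \<forall>c2\<in>?O. c1 \<noteq> c2 \<longrightarrow> c1 \<inter> c2 = {}"
      using disjoint_union by (auto simp: orbits_def)
  qed
  then have "p dvd card E - 1" using un e fin by simp
  moreover have "card E > 0" using e fin by (auto simp: card_gt_0_iff)
  ultimately have "p dvd 1" using p(2) by (metis dvd_diffD1 Suc_leI One_nat_def)
  then show False using p(1) by (simp add: not_prime_unit)
qed

context group
begin

section \<open>The action of \<open>G\<close> on the cosets of \<open>K\<close> in
  \<open>H\<close>\<close>

lemma r_coset_eq_iff:
  assumes "subgroup K G" "x \<in> carrier G" "y \<in> carrier G"
  shows "K #> x = K #> y \<longleftrightarrow> x \<otimes> inv y \<in> K"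
  using assms repr_independence[of x K y] repr_independenceD[of K x y]
    subgroup.rcos_module[OF assms(1) is_group, of y x] by metis

lemma carrier_factor: "carrier (factor G H K) = (\<lambda>h. K #> h) ` H"
  by (auto simp: FactGroup_def RCOSETS_def r_coset_def)

lemma conj_factor_fixed_iff:
  assumes H: "H \<lhd> G" and K: "K \<lhd> G" and g: "g \<in> carrier G" and y: "y \<in> H"
  shows "conj_factor G H K g (K #> y) = K #> y \<longleftrightarrow> comm g y \<in> K"
proof -
  have "y \<in> carrier G" using subgroup.mem_carrier[OF normal_imp_subgroup[OF H] y] .
  then show ?thesis
    using conj_factor_coset[OF assms] r_coset_eq_iff[OF normal_imp_subgroup[OF K]] g
    by (simp add: comm_def)
qed

lemma conj_factor_in_factor:
  assumes "H \<lhd> G" "K \<lhd> G" "g \<in> carrier G" "X \<in> carrier (factor G H K)"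
  shows "conj_factor G H K g X \<in> carrier (factor G H K)"
  using assms conj_factor_coset[OF assms(1-3)] normal.inv_op_closed2[OF assms(1)]
  unfolding carrier_factor by auto

lemma conj_factor_one:
  assumes H: "H \<lhd> G" and K: "K \<lhd> G" and X: "X \<in> carrier (factor G H K)"
  shows "conj_factor G H K \<one> X = X"
proof -
  obtain h where h: "h \<in> H" "X = K #> h" using X unfolding carrier_factor by blast
  then have "h \<in> carrier G" using H by (meson normal_imp_subgroup subgroup.mem_carrier)
  then show ?thesis using h conj_factor_coset[OF H K one_closed h(1)] by simp
qed

lemma conj_factor_group_action:
  assumes H: "H \<lhd> G" and K: "K \<lhd> G"
  shows "group_action G (carrier (factor G H K)) (conj_factor G H K)"
proof -
  let ?E = "carrier (factor G H K)" and ?f = "conj_factor G H K"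
  note closed = conj_factor_in_factor[OF H K]
  have ext: "?f g \<in> extensional ?E" for g by (simp add: conj_factor_def)
  have inverse: "?f g (?f (inv g) X) = X" "?f (inv g) (?f g X) = X"
    if "g \<in> carrier G" "X \<in> ?E" for g X
    using that conj_factor_mult[OF H K that(1) inv_closed[OF that(1)] that(2)]
      conj_factor_mult[OF H K inv_closed[OF that(1)] that] conj_factor_one[OF H K that(2)]
    by auto
  have bij: "?f g \<in> Bij ?E" if g: "g \<in> carrier G" for g
  proof -
    have "bij_betw (?f g) ?E ?E"
      by (rule bij_betw_byWitness[where f' = "?f (inv g)"])
        (use inverse[OF g] closed[OF g] closed[OF inv_closed[OF g]] in auto)
    then show ?thesis using ext by (simp add: Bij_def)
  qed
  have "?f (g \<otimes> g') = compose ?E (?f g) (?f g')" if "g \<in> carrier G" "g' \<in> carrier G" for g g'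
  proof
    show "?f (g \<otimes> g') X = compose ?E (?f g) (?f g') X" for X
      using conj_factor_mult[OF H K that, of X] ext[of "g \<otimes> g'"]
      by (cases "X \<in> ?E") (auto simp: compose_def extensional_def)
  qed
  then have "?f \<in> hom G (BijGroup ?E)" using bij by (auto simp: hom_def BijGroup_def)
  then show ?thesis
    by (intro group_action.intro group_hom.intro group_hom_axioms.intro is_group group_BijGroup)
qed

text \<open>Every nontrivial coset has order \<open>p\<close> in the quotient, and its order divides
  the order of the group.\<close>

lemma prime_dvd_card_factor:
  fixes p :: nat
  assumes H: "H \<lhd> G" and K: "K \<lhd> G" and KH: "K \<subset> H"
    and p: "prime p" "\<And>x. x \<in> H \<Longrightarrow> x [^] p \<in> K"
  shows "p dvd card (carrier (factor G H K))"
proof -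
  let ?G' = "G\<lparr>carrier := H\<rparr>" and ?Q = "factor G H K"
  have sH: "subgroup H G" and sK: "subgroup K G" using H K normal_imp_subgroup by auto
  interpret G': group ?G' using subgroup_imp_group[OF sH] .
  have n: "K \<lhd> ?G'" using normal_restrict_supergroup[OF sH K] KH by blast
  have hom: "group_hom ?G' ?Q (\<lambda>a. K #>\<^bsub>?G'\<^esub> a)"
    using G'.quotient_hom G'.normal_in_carrier_iff n by blast
  interpret Q: group ?Q using normal.factorgroup_is_group[OF n] .
  obtain y where y: "y \<in> H" "y \<notin> K" using KH by blast
  have yG: "y \<in> carrier G" using y subgroup.mem_carrier[OF sH] by blast
  let ?y = "K #> y"
  have yQ: "?y \<in> carrier ?Q" using y carrier_factor by blast
  have "?y [^]\<^bsub>?Q\<^esub> p = K #> (y [^] p)"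
    using group_hom.hom_nat_pow[OF hom, of y p] y(1) nat_pow_consistent[of y p H]
    by (simp add: r_coset_def)
  also have "\<dots> = \<one>\<^bsub>?Q\<^esub>" using p(2)[OF y(1)] coset_join2[of "y [^] p" K] yG sK by simp
  finally have "Q.ord ?y dvd p" using Q.pow_eq_id[OF yQ] by simp
  moreover have "Q.ord ?y dvd card (carrier ?Q)"
    using Q.pow_eq_id[OF yQ] Q.pow_order_eq_1[OF yQ] by (simp add: order_def)
  moreover have "Q.ord ?y \<noteq> 1"
    using Q.ord_eq_1[OF yQ] coset_join1[OF _ yG sK] y(2) by auto
  ultimately show ?thesis using p(1) by (metis prime_nat_iff)
qed

lemma inner_on_abelian_chief_factor:
  assumes fin: "finite (carrier G)" and chief: "chief_in (carrier G) H K"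
    and ab: "\<And>x y. x \<in> H \<Longrightarrow> y \<in> H \<Longrightarrow> comm x y \<in> K"
    and cover: "\<And>g. g \<in> carrier G \<Longrightarrow> \<exists>M. subgroup M G \<and> quasi_in M \<and> g \<in> M \<and> H \<subseteq> M"
  shows "inner_on (carrier G) H K"
proof -
  have H: "normal_in (carrier G) H" and K: "normal_in (carrier G) K" and KH: "K \<subset> H"
    using chief by (auto simp: chief_in_def)
  have Hn: "H \<lhd> G" and Kn: "K \<lhd> G" using H K by (simp_all add: normal_in_carrier_iff)
  have HG: "H \<subseteq> carrier G" using normal_inD(3)[OF H] .
  have sK: "subgroup K G" using normal_inD(1)[OF K] .
  obtain p :: nat where p: "prime p" "\<And>x. x \<in> H \<Longrightarrow> x [^] p \<in> K"
    using abelian_chief_factor_exponent[OF fin chief ab] by blast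
  let ?C = "{g \<in> carrier G. \<forall>y\<in>H. comm g y \<in> K}"
  have C: "normal_in (carrier G) ?C"
    using normal_in_centralizer[OF subgroup_self normal_in_self[OF subgroup_self] K HG
        normal_inD(7)[OF H]] .
  have "x \<in> ?C" if x: "x \<in> carrier G" and n: "x [^] (n::nat) = \<one>" and cop: "coprime n p" for x n
  proof -
    obtain M where M: "subgroup M G" "quasi_in M" "x \<in> M" "H \<subseteq> M" using cover[OF x] by blast
    have MG: "M \<subseteq> carrier G" using subgroup.subset[OF M(1)] .
    have HnM: "normal_in M H" using normal_in_mono[OF H MG M(4)] .
    have KnM: "normal_in M K" using normal_in_mono[OF K MG] KH M(4) by blast
    \<comment> \<open>\<open>W\<close> will be a largest such subgroup; if it is not
      \<open>H\<close>, the next chief factor \<open>L/W\<close> of \<open>M\<close> gives a larger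
      one.\<close>
    define P where "P W \<longleftrightarrow> normal_in M W \<and> K \<subseteq> W \<and> W \<subseteq> H \<and> (\<forall>w\<in>W. comm x w \<in> K)" for W
    have "P K" unfolding P_def using KnM KH normal_in_comm(1)[OF KnM MG M(3)] by blast
    then have "\<exists>W. P W \<and> K \<subseteq> W \<and> (\<forall>C. P C \<longrightarrow> W \<subseteq> C \<longrightarrow> C = W)"
      using KH finite_subset[OF HG fin]
      by (intro ex_maximal_set[of H]) (auto simp: P_def)
    then obtain W where "P W" and max: "\<And>C. P C \<Longrightarrow> W \<subseteq> C \<Longrightarrow> C = W" by blast
    then have W: "normal_in M W" and KW: "K \<subseteq> W" and WH: "W \<subseteq> H"
      and xW: "\<And>w. w \<in> W \<Longrightarrow> comm x w \<in> K"
      by (auto simp: P_def)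
    have "W = H"
    proof (rule ccontr)
      assume "W \<noteq> H"
      then have "W \<subset> H" using WH by blast
      then obtain L where LH: "L \<subseteq> H" and cL: "chief_in M L W"
        using ex_chief_in[OF finite_subset[OF HG fin] HnM W] by blast
      have L: "normal_in M L" and WL: "W \<subset> L" using cL by (auto simp: chief_in_def)
      have "inner_on M L W" using M(2) cL by (simp add: quasi_in_def)
      then obtain l where l: "l \<in> L" "\<forall>y\<in>L. comm (inv l \<otimes> x) y \<in> W"
        using M(3) unfolding inner_on_def by blast
      have lM: "l \<in> M" and lG: "l \<in> carrier G" using l(1) LH M(4) MG by auto
      let ?c = "inv l \<otimes> x"
      have "comm x u \<in> K" if u: "u \<in> L" for u
      proof -
        have uG: "u \<in> carrier G" using u LH HG by blast
        \<comment> \<open>On \<open>L/W\<close>, \<open>x\<close> acts like \<open>l\<close>, which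
          acts trivially because \<open>H/K\<close> is abelian. So commutators of \<open>x\<close>
          with \<open>L\<close> fall into \<open>W\<close>, where \<open>x\<close> acts trivially
          modulo \<open>K\<close>, and coprime action applies.\<close>
        have "x = l \<otimes> ?c" using lG x by (simp add: mult_inv_cancel)
        then have "comm x u = (l \<otimes> comm ?c u \<otimes> inv l) \<otimes> comm l u"
          using comm_mult_left[of l ?c u] lG x uG by simp
        moreover have "l \<otimes> comm ?c u \<otimes> inv l \<in> W" using normal_inD(7)[OF W lM] l(2) u by blast
        moreover have "comm l u \<in> W" using ab l(1) u LH KW by blast
        ultimately have w: "comm x u \<in> W" using normal_inD(5)[OF W] by simp
        then have "comm x u [^] p \<in> K" using p(2) WH by blast
        then show ?thesis using commutator_pow_in_normal[OF K x uG xW[OF w] n _ cop] by blast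
      qed
      then have "P L" unfolding P_def using L KW WL LH by blast
      then show False using max[of L] WL by blast
    qed
    then show ?thesis using xW x by blast
  qed
  then obtain k where k: "order G dvd p ^ k * card ?C"
    using prime_power_index[OF fin normal_inD(1)[OF C] p(1)] by blast
  let ?E = "carrier (factor G H K)" and ?f = "conj_factor G H K"
  \<comment> \<open>\<open>K\<close> is the trivial coset, the fixed point that is known
    beforehand.\<close>
  have e: "K \<in> ?E" using carrier_factor coset_mult_one normal_inD(3)[OF K] normal_inD(4)[OF H]
    by (metis imageI)
  note f = conj_factor_fixed_iff[OF Hn Kn]
  have "\<exists>X\<in>?E. X \<noteq> K \<and> (\<forall>g\<in>carrier G. ?f g X = X)"
  proof (rule group_action.prime_fixed_point[OF conj_factor_group_action[OF Hn Kn] fin _ p(1)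
        _ normal_inD(1)[OF C] _ k e])
    show "finite ?E" unfolding carrier_factor using finite_subset[OF HG fin] by blast
    show "p dvd card ?E" using prime_dvd_card_factor[OF Hn Kn KH p] .
    show "?f c X = X" if "c \<in> ?C" "X \<in> ?E" for c X
      using that f unfolding carrier_factor by blast
    show "?f g K = K" if "g \<in> carrier G" for g
      using f[OF that normal_inD(4)[OF H]] that normal_inD(3,4)[OF K] by simp
  qed
  then obtain y where y: "y \<in> H" "K #> y \<noteq> K" "\<And>g. g \<in> carrier G \<Longrightarrow> comm g y \<in> K"
    using f unfolding carrier_factor by blast
  have yG: "y \<in> carrier G" using y HG by blast
  \<comment> \<open>The fixed points, collected into a normal subgroup of \<open>G\<close>; one of
    them outside \<open>K\<close> makes it all of \<open>H\<close>.\<close>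
  let ?Z = "{x \<in> H. \<forall>g\<in>carrier G. comm x g \<in> K}"
  have Z: "normal_in (carrier G) ?Z"
    by (rule normal_in_centralizer[OF subgroup_self H K]) auto
  have "y \<in> ?Z"
  proof -
    have "comm y g \<in> K" if "g \<in> carrier G" for g
      using normal_inD(6)[OF K y(3)[OF that]] inv_comm[OF that yG] by simp
    then show ?thesis using y(1) by blast
  qed
  moreover have "y \<notin> K" using y(2) coset_join2[OF yG sK] by blast
  moreover have "K \<subseteq> ?Z" using normal_in_comm(2)[OF K subset_refl] KH by blast
  ultimately have "?Z = H" using chief_in_cases[OF chief Z] by blast
  then have Z': "\<And>x g. x \<in> H \<Longrightarrow> g \<in> carrier G \<Longrightarrow> comm x g \<in> K" by blast
  show ?thesis unfolding inner_on_def
  proof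
    fix g assume g: "g \<in> carrier G"
    have "comm (inv \<one> \<otimes> g) x \<in> K" if "x \<in> H" for x
      using normal_inD(6)[OF K Z'[OF that g]] inv_comm[of x g] that HG g by auto
    then show "\<exists>h\<in>H. \<forall>x\<in>H. comm (inv h \<otimes> g) x \<in> K" using normal_inD(4)[OF H] by blast
  qed
qed

text \<open>A nonabelian factor is settled for each \<open>g\<close> by its own \<open>M\<close>; an
  abelian one needs the covering subgroups of all elements together.\<close>

lemma inner_on_chief_factor_cover:
  assumes fin: "finite (carrier G)" and chief: "chief_in (carrier G) H K"
    and cover: "\<And>g. g \<in> carrier G \<Longrightarrow> \<exists>M. subgroup M G \<and> quasi_in M \<and> g \<in> M \<and> H \<subseteq> M"
  shows "inner_on (carrier G) H K"
proof (cases "\<forall>x\<in>H. \<forall>y\<in>H. comm x y \<in> K")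
  case True
  then show ?thesis using inner_on_abelian_chief_factor[OF fin chief _ cover] by blast
next
  case False
  then obtain a b where ab: "a \<in> H" "b \<in> H" "comm a b \<notin> K" by blast
  show ?thesis unfolding inner_on_def
  proof
    fix g assume "g \<in> carrier G"
    then obtain M where M: "subgroup M G" "quasi_in M" "g \<in> M" "H \<subseteq> M" using cover by blast
    then have "inner_on M H K"
      using inner_on_nonabelian_chief_factor_subgroup[OF fin chief ab] by blast
    then show "\<exists>h\<in>H. \<forall>y\<in>H. comm (inv h \<otimes> g) y \<in> K" using M(3) unfolding inner_on_def by blast
  qed
qed

end

section \<open>Quasinilpotency in terms of inner action\<close>

context group
begin

lemma chief_factor_iff: "chief_factor G H K \<longleftrightarrow> chief_in (carrier G) H K"
  by (simp add: chief_factor_def chief_in_def normal_in_carrier_iff)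

text \<open>Conjugation by the coset of \<open>h\<close> in the quotient is the map induced by
  conjugation with \<open>h\<close> in \<open>G\<close>. Membership in \<open>inner_auto\<close>
  thus becomes the choice of an \<open>h\<close> in \<open>H\<close>, as in
  \<open>inner_on\<close>.\<close>

lemma inner_auto_factor:
  assumes H: "H \<lhd> G" and K: "K \<lhd> G" and KH: "K \<subseteq> H"
  shows "inner_auto (factor G H K) = conj_factor G H K ` H"
proof -
  let ?Q = "factor G H K"
  have sH: "subgroup H G" using normal_imp_subgroup[OF H] .
  have n: "K \<lhd> G\<lparr>carrier := H\<rparr>" using normal_restrict_supergroup[OF sH K KH] .
  interpret Q: group ?Q using normal.factorgroup_is_group[OF n] .
  interpret G': group "G\<lparr>carrier := H\<rparr>" using subgroup_imp_group[OF sH] .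
  interpret q: group_hom "G\<lparr>carrier := H\<rparr>" ?Q "\<lambda>a. K #> a"
    using G'.quotient_hom[of K] G'.normal_in_carrier_iff n by (simp add: r_coset_def)
  have conj: "(K #> h) \<otimes>\<^bsub>?Q\<^esub> (K #> y) \<otimes>\<^bsub>?Q\<^esub> inv\<^bsub>?Q\<^esub> (K #> h) = conj_factor G H K h (K #> y)"
    if "h \<in> H" "y \<in> H" for h y
  proof -
    have ih: "inv h \<in> H" and hy: "h \<otimes> y \<in> H" and hG: "h \<in> carrier G"
      using that subgroup.m_inv_closed[OF sH] subgroup.m_closed[OF sH] subgroup.mem_carrier[OF sH]
      by auto
    have "inv\<^bsub>?Q\<^esub> (K #> h) = K #> inv h"
      using q.hom_inv[of h] that(1) m_inv_consistent[OF sH that(1)] by simp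
    moreover have "K #> (h \<otimes> y) = (K #> h) \<otimes>\<^bsub>?Q\<^esub> (K #> y)"
      using q.hom_mult[of h y] that by simp
    moreover have "K #> (h \<otimes> y \<otimes> inv h) = (K #> (h \<otimes> y)) \<otimes>\<^bsub>?Q\<^esub> (K #> inv h)"
      using q.hom_mult[of "h \<otimes> y" "inv h"] ih hy by simp
    ultimately show ?thesis by (simp only: conj_factor_coset[OF H K hG that(2)])
  qed
  have eq: "(\<lambda>x\<in>carrier ?Q. (K #> h) \<otimes>\<^bsub>?Q\<^esub> x \<otimes>\<^bsub>?Q\<^esub> inv\<^bsub>?Q\<^esub> (K #> h)) = conj_factor G H K h"
    if "h \<in> H" for h
  proof
    show "(\<lambda>x\<in>carrier ?Q. (K #> h) \<otimes>\<^bsub>?Q\<^esub> x \<otimes>\<^bsub>?Q\<^esub> inv\<^bsub>?Q\<^esub> (K #> h)) X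
        = conj_factor G H K h X" for X
    proof (cases "X \<in> carrier ?Q")
      case True
      then obtain y where "y \<in> H" "X = K #> y" unfolding carrier_factor by blast
      then show ?thesis using conj[OF that] True by simp
    qed (simp add: conj_factor_def)
  qed
  have "inner_auto ?Q
      = (\<lambda>h. \<lambda>x\<in>carrier ?Q. (K #> h) \<otimes>\<^bsub>?Q\<^esub> x \<otimes>\<^bsub>?Q\<^esub> inv\<^bsub>?Q\<^esub> (K #> h)) ` H"
    unfolding inner_auto_def carrier_factor by blast
  also have "\<dots> = conj_factor G H K ` H" by (rule image_cong[OF refl eq])
  finally show ?thesis .
qed

lemma conj_factor_eq_iff:
  assumes H: "H \<lhd> G" and K: "K \<lhd> G" and g: "g \<in> carrier G" "h \<in> carrier G"
  shows "conj_factor G H K g = conj_factor G H K h \<longleftrightarrow> (\<forall>y\<in>H. comm (inv h \<otimes> g) y \<in> K)"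
proof -
  let ?E = "carrier (factor G H K)" and ?f = "conj_factor G H K"
  have nK: "normal_in (carrier G) K" using K by (simp add: normal_in_carrier_iff)
  have sK: "subgroup K G" using normal_imp_subgroup[OF K] .
  have HG: "H \<subseteq> carrier G" using H by (simp add: normal_imp_subgroup subgroup.subset)
  have "?f g = ?f h \<longleftrightarrow> (\<forall>X\<in>?E. ?f g X = ?f h X)"
    by (auto simp: conj_factor_def fun_eq_iff)
  also have "\<dots> \<longleftrightarrow> (\<forall>y\<in>H. ?f g (K #> y) = ?f h (K #> y))"
    unfolding carrier_factor by blast
  also have "\<dots> \<longleftrightarrow> (\<forall>y\<in>H. comm (inv h \<otimes> g) y \<in> K)"
  proof (rule ball_cong[OF refl])
    fix y assume y: "y \<in> H"
    then have yG: "y \<in> carrier G" using HG by blast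
    \<comment> \<open>\<open>?k\<close> measures the difference of the two images of
      \<open>K #> y\<close>, and it is the conjugate by \<open>h\<close> of
      \<open>comm (inv h \<otimes> g) y\<close>.\<close>
    let ?k = "g \<otimes> y \<otimes> inv g \<otimes> inv (h \<otimes> y \<otimes> inv h)"
    have "?f g (K #> y) = ?f h (K #> y) \<longleftrightarrow> ?k \<in> K"
      using conj_factor_coset[OF H K _ y] r_coset_eq_iff[OF sK] g yG by simp
    also have "\<dots> \<longleftrightarrow> comm (inv h \<otimes> g) y \<in> K"
    proof
      assume "?k \<in> K"
      then have "inv h \<otimes> ?k \<otimes> inv (inv h) \<in> K" using normal_inD(7)[OF nK] g by blast
      then show "comm (inv h \<otimes> g) y \<in> K" using g yG by (simp add: comm_def group_word_simps)
    next
      assume "comm (inv h \<otimes> g) y \<in> K"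
      then have "h \<otimes> comm (inv h \<otimes> g) y \<otimes> inv h \<in> K" using normal_inD(7)[OF nK] g by blast
      then show "?k \<in> K" using g yG by (simp add: comm_def group_word_simps)
    qed
    finally show "?f g (K #> y) = ?f h (K #> y) \<longleftrightarrow> comm (inv h \<otimes> g) y \<in> K" .
  qed
  finally show ?thesis .
qed

lemma inner_on_iff:
  assumes H: "H \<lhd> G" and K: "K \<lhd> G" and KH: "K \<subseteq> H"
  shows "inner_on (carrier G) H K \<longleftrightarrow>
    (\<forall>x\<in>carrier G. conj_factor G H K x \<in> inner_auto (factor G H K))"
proof -
  have "h \<in> carrier G" if "h \<in> H" for h
    using that normal_imp_subgroup[OF H] by (simp add: subgroup.mem_carrier)
  then show ?thesis
    unfolding inner_on_def inner_auto_factor[OF assms] image_iff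
    using conj_factor_eq_iff[OF H K] by (intro ball_cong bex_cong) auto
qed

lemma quasinilpotent_iff:
  assumes "finite (carrier G)"
  shows "quasinilpotent G \<longleftrightarrow> quasi_in (carrier G)"
proof -
  have "inner_on (carrier G) H K \<longleftrightarrow>
      (\<forall>x\<in>carrier G. conj_factor G H K x \<in> inner_auto (factor G H K))"
    if "chief_in (carrier G) H K" for H K
    using that inner_on_iff[of H K] by (auto simp: chief_in_def normal_in_carrier_iff)
  then show ?thesis
    using assms is_group unfolding quasinilpotent_def quasi_in_def chief_factor_iff by blast
qed

text \<open>The relative notions only apply the operations of \<open>G\<close> to elements of
  \<open>X\<close>, where they agree with those of the restricted group.\<close>

lemma quasinilpotent_subgroup_iff:
  assumes fin: "finite (carrier G)" and X: "subgroup X G"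
  shows "quasinilpotent (G\<lparr>carrier := X\<rparr>) \<longleftrightarrow> quasi_in X"
proof -
  let ?X = "G\<lparr>carrier := X\<rparr>"
  interpret X: group ?X using subgroup_imp_group[OF X] .
  have sub: "subgroup H ?X \<longleftrightarrow> subgroup H G \<and> H \<subseteq> X" for H
    using incl_subgroup[OF X] subgroup_incl[OF _ X] subgroup.subset[of H ?X] by auto
  have n: "X.normal_in X H \<longleftrightarrow> normal_in X H" for H
    unfolding X.normal_in_def normal_in_def sub using m_inv_consistent[OF X] by auto
  have c: "X.chief_in X H K \<longleftrightarrow> chief_in X H K" for H K
    unfolding X.chief_in_def chief_in_def n ..
  have comm: "X.comm x y = comm x y" if "x \<in> X" "y \<in> X" for x y
    unfolding X.comm_def comm_def using m_inv_consistent[OF X] that by simp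
  have "X.inner_on X H K \<longleftrightarrow> inner_on X H K" if "H \<subseteq> X" for H K
    unfolding X.inner_on_def inner_on_def
  proof (intro ball_cong bex_cong refl)
    fix x h y assume "x \<in> X" "h \<in> H" "y \<in> H"
    then have m: "x \<in> X" "h \<in> X" "y \<in> X" using that by auto
    then have "inv h \<otimes> x \<in> X"
      using subgroup.m_closed[OF X] subgroup.m_inv_closed[OF X] by blast
    then show "X.comm (inv\<^bsub>?X\<^esub> h \<otimes>\<^bsub>?X\<^esub> x) y \<in> K \<longleftrightarrow> comm (inv h \<otimes> x) y \<in> K"
      using comm m m_inv_consistent[OF X] by simp
  qed
  then have "X.quasi_in X \<longleftrightarrow> quasi_in X"
    unfolding X.quasi_in_def quasi_in_def c using normal_inD(2) by (auto simp: chief_in_def)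
  moreover have "finite (carrier ?X)" using finite_subset[OF subgroup.subset[OF X] fin] by simp
  ultimately show ?thesis using X.quasinilpotent_iff by simp
qed

end

section \<open>Semidirect products with chief factors\<close>

text \<open>
  \<open>S\<close> abstracts from the semidirect product of \<open>H/K\<close> by \<open>G/C\<close>, where \<open>C\<close> is the centralizer of \<open>H/K\<close>
  in \<open>G\<close>; the images of \<open>\<iota>\<close> and \<open>\<sigma>\<close> are the two factors.
\<close>
locale chief_factor_extension = group G + S: group S
  for G (structure) and S (structure) +
  fixes H K :: "'a set" and \<iota> \<sigma> :: "'a \<Rightarrow> 'c"
  assumes chief: "chief_in (carrier G) H K"
    and hom_\<iota>: "\<iota> \<in> hom (G\<lparr>carrier := H\<rparr>) S"
    and hom_\<sigma>: "\<sigma> \<in> hom G S"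
    and carrier_S: "carrier S = {\<iota> h \<otimes>\<^bsub>S\<^esub> \<sigma> g | h g. h \<in> H \<and> g \<in> carrier G}"
    and conj_\<iota>: "g \<in> carrier G \<Longrightarrow> h \<in> H \<Longrightarrow> \<sigma> g \<otimes>\<^bsub>S\<^esub> \<iota> h \<otimes>\<^bsub>S\<^esub> inv\<^bsub>S\<^esub> \<sigma> g = \<iota> (g \<otimes> h \<otimes> inv g)"
    and ker_\<iota>: "h \<in> H \<Longrightarrow> \<iota> h = \<one>\<^bsub>S\<^esub> \<longleftrightarrow> h \<in> K"
    and ker_\<sigma>: "g \<in> carrier G \<Longrightarrow> (\<And>y. y \<in> H \<Longrightarrow> comm g y \<in> K) \<Longrightarrow> \<sigma> g = \<one>\<^bsub>S\<^esub>"
begin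

lemma H: "normal_in (carrier G) H" and K: "normal_in (carrier G) K" and KH: "K \<subset> H"
  using chief by (auto simp: chief_in_def)

lemma HG: "H \<subseteq> carrier G" and KG: "K \<subseteq> carrier G"
  using normal_inD(3) H K by auto

lemma group_hom_\<iota>: "group_hom (G\<lparr>carrier := H\<rparr>) S \<iota>"
  using hom_\<iota> subgroup_imp_group[OF normal_inD(1)[OF H]]
  by (simp add: group_hom_def group_hom_axioms_def S.is_group)

lemma group_hom_\<sigma>: "group_hom G S \<sigma>"
  using hom_\<sigma> by (simp add: group_hom_def group_hom_axioms_def is_group S.is_group)

lemma \<iota>_simps:
  shows "x \<in> H \<Longrightarrow> \<iota> x \<in> carrier S"
    and "x \<in> H \<Longrightarrow> y \<in> H \<Longrightarrow> \<iota> (x \<otimes> y) = \<iota> x \<otimes>\<^bsub>S\<^esub> \<iota> y"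
    and "x \<in> H \<Longrightarrow> \<iota> (inv x) = inv\<^bsub>S\<^esub> \<iota> x"
  using group_hom.hom_closed[OF group_hom_\<iota>] group_hom.hom_mult[OF group_hom_\<iota>]
    group_hom.hom_inv[OF group_hom_\<iota>, of x] m_inv_consistent[OF normal_inD(1)[OF H]]
  by auto

lemma \<sigma>_simps:
  shows "x \<in> carrier G \<Longrightarrow> \<sigma> x \<in> carrier S"
    and "x \<in> carrier G \<Longrightarrow> y \<in> carrier G \<Longrightarrow> \<sigma> (x \<otimes> y) = \<sigma> x \<otimes>\<^bsub>S\<^esub> \<sigma> y"
    and "x \<in> carrier G \<Longrightarrow> \<sigma> (inv x) = inv\<^bsub>S\<^esub> \<sigma> x"
  using group_hom.hom_closed[OF group_hom_\<sigma>] group_hom.hom_mult[OF group_hom_\<sigma>]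
    group_hom.hom_inv[OF group_hom_\<sigma>] by auto

lemma carrier_S_cases:
  assumes "s \<in> carrier S"
  obtains h g where "h \<in> H" "g \<in> carrier G" "s = \<iota> h \<otimes>\<^bsub>S\<^esub> \<sigma> g"
  using assms unfolding carrier_S by blast

lemma \<iota>_comm:
  assumes h: "h \<in> H" and g: "g \<in> carrier G" and y: "y \<in> H"
  shows "S.comm (inv\<^bsub>S\<^esub> \<iota> h \<otimes>\<^bsub>S\<^esub> \<sigma> g) (\<iota> y) = \<iota> (comm (inv h \<otimes> g) y)"
proof -
  have mem: "inv h \<in> H" "inv y \<in> H" "g \<otimes> y \<otimes> inv g \<in> H"
    "inv h \<otimes> (g \<otimes> y \<otimes> inv g) \<in> H" "inv h \<otimes> (g \<otimes> y \<otimes> inv g) \<otimes> h \<in> H"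
    using assms normal_inD(5,6)[OF H] normal_inD(7)[OF H g y] by auto
  have car: "\<iota> h \<in> carrier S" "\<iota> y \<in> carrier S" "\<sigma> g \<in> carrier S" "h \<in> carrier G" "y \<in> carrier G"
    using assms \<iota>_simps(1) \<sigma>_simps(1) HG by auto
  have "comm (inv h \<otimes> g) y = inv h \<otimes> (g \<otimes> y \<otimes> inv g) \<otimes> h \<otimes> inv y"
    using car g by (simp add: comm_def group_word_simps)
  then have "\<iota> (comm (inv h \<otimes> g) y)
      = inv\<^bsub>S\<^esub> \<iota> h \<otimes>\<^bsub>S\<^esub> (\<sigma> g \<otimes>\<^bsub>S\<^esub> \<iota> y \<otimes>\<^bsub>S\<^esub> inv\<^bsub>S\<^esub> \<sigma> g) \<otimes>\<^bsub>S\<^esub> \<iota> h \<otimes>\<^bsub>S\<^esub> inv\<^bsub>S\<^esub> \<iota> y"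
    using mem h y \<iota>_simps(2,3) conj_\<iota>[OF g y] by simp
  also have "\<dots> = S.comm (inv\<^bsub>S\<^esub> \<iota> h \<otimes>\<^bsub>S\<^esub> \<sigma> g) (\<iota> y)"
    using car by (simp add: S.comm_def S.group_word_simps)
  finally show ?thesis ..
qed

lemma \<sigma>_eq_one: "h \<in> K \<Longrightarrow> \<sigma> h = \<one>\<^bsub>S\<^esub>"
  using ker_\<sigma>[of h] normal_in_comm(2)[OF K subset_refl] HG KH by blast

lemma normal_\<iota>: "S.normal_in (carrier S) (\<iota> ` H)"
  unfolding S.normal_in_def
proof (intro conjI ballI)
  show "subgroup (\<iota> ` H) S"
    using group_hom.img_is_subgroup[OF group_hom_\<iota>] by simp
  show "\<iota> ` H \<subseteq> carrier S" using \<iota>_simps(1) by blast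
  fix s a assume s: "s \<in> carrier S" and "a \<in> \<iota> ` H"
  then obtain y where y: "y \<in> H" "a = \<iota> y" by blast
  obtain h g where hg: "h \<in> H" "g \<in> carrier G" "s = \<iota> h \<otimes>\<^bsub>S\<^esub> \<sigma> g"
    using s by (rule carrier_S_cases)
  have c: "\<iota> h \<in> carrier S" "\<iota> y \<in> carrier S" "\<sigma> g \<in> carrier S"
    using hg y \<iota>_simps(1) \<sigma>_simps(1) by auto
  have gy: "g \<otimes> y \<otimes> inv g \<in> H" using normal_inD(7)[OF H hg(2) y(1)] .
  have "s \<otimes>\<^bsub>S\<^esub> a \<otimes>\<^bsub>S\<^esub> inv\<^bsub>S\<^esub> s
      = \<iota> h \<otimes>\<^bsub>S\<^esub> (\<sigma> g \<otimes>\<^bsub>S\<^esub> \<iota> y \<otimes>\<^bsub>S\<^esub> inv\<^bsub>S\<^esub> \<sigma> g) \<otimes>\<^bsub>S\<^esub> inv\<^bsub>S\<^esub> \<iota> h"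
    using c hg(3) y(2) by (simp add: S.group_word_simps)
  also have "\<dots> = \<iota> (h \<otimes> (g \<otimes> y \<otimes> inv g) \<otimes> inv h)"
    using conj_\<iota>[OF hg(2) y(1)] hg(1) gy \<iota>_simps(2,3) normal_inD(5,6)[OF H] by simp
  finally show "s \<otimes>\<^bsub>S\<^esub> a \<otimes>\<^bsub>S\<^esub> inv\<^bsub>S\<^esub> s \<in> \<iota> ` H"
    using hg(1) gy normal_inD(5,6)[OF H] by blast
qed

text \<open>A normal subgroup of \<open>S\<close> inside the image of \<open>H\<close> pulls back
  along \<open>\<iota>\<close> to a subgroup between \<open>K\<close> and \<open>H\<close>, which
  \<open>conj_\<iota>\<close> makes normal in \<open>G\<close>.\<close>

lemma chief_\<iota>: "S.chief_in (carrier S) (\<iota> ` H) {\<one>\<^bsub>S\<^esub>}"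
  unfolding S.chief_in_def
proof (intro conjI notI)
  show "S.normal_in (carrier S) (\<iota> ` H)" by (rule normal_\<iota>)
  show "S.normal_in (carrier S) {\<one>\<^bsub>S\<^esub>}" by (rule S.normal_in_one[OF S.subgroup_self])
  have "\<one>\<^bsub>S\<^esub> \<in> \<iota> ` H" using S.normal_inD(4)[OF normal_\<iota>] .
  moreover obtain h where "h \<in> H" "\<iota> h \<noteq> \<one>\<^bsub>S\<^esub>" using KH ker_\<iota> by blast
  ultimately show "{\<one>\<^bsub>S\<^esub>} \<subset> \<iota> ` H" by blast
  assume "\<exists>L. S.normal_in (carrier S) L \<and> {\<one>\<^bsub>S\<^esub>} \<subset> L \<and> L \<subset> \<iota> ` H"
  then obtain L where L: "S.normal_in (carrier S) L" "{\<one>\<^bsub>S\<^esub>} \<subset> L" "L \<subset> \<iota> ` H" by blast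
  let ?N = "{h \<in> H. \<iota> h \<in> L}"
  have "normal_in (carrier G) ?N" unfolding normal_in_def
  proof (intro conjI ballI)
    show NG: "?N \<subseteq> carrier G" using HG by blast
    show "subgroup ?N G"
    proof (rule subgroupI[OF NG])
      have "\<one> \<in> ?N"
        using normal_inD(4)[OF H] normal_inD(4)[OF K] ker_\<iota>[OF normal_inD(4)[OF H]]
          S.normal_inD(4)[OF L(1)] by simp
      then show "?N \<noteq> {}" by blast
      show "inv x \<in> ?N" if "x \<in> ?N" for x
        using that \<iota>_simps(3) normal_inD(6)[OF H] S.normal_inD(6)[OF L(1)] by simp
      show "x \<otimes> y \<in> ?N" if "x \<in> ?N" "y \<in> ?N" for x y
        using that \<iota>_simps(2) normal_inD(5)[OF H] S.normal_inD(5)[OF L(1)] by simp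
    qed
    fix g y assume "g \<in> carrier G" "y \<in> ?N"
    then show "g \<otimes> y \<otimes> inv g \<in> ?N"
      using normal_inD(7)[OF H, of g y] S.normal_inD(7)[OF L(1) \<sigma>_simps(1)[of g], of "\<iota> y"]
        conj_\<iota>[of g y] by simp
  qed
  moreover have "K \<subseteq> ?N"
  proof
    fix x assume "x \<in> K"
    then have "x \<in> H" "\<iota> x = \<one>\<^bsub>S\<^esub>" using ker_\<iota>[of x] KH by auto
    then show "x \<in> ?N" using S.normal_inD(4)[OF L(1)] by simp
  qed
  ultimately consider "?N = K" | "?N = H" using chief_in_cases[OF chief] by blast
  then show False
  proof cases
    case 1
    then have "L \<subseteq> {\<one>\<^bsub>S\<^esub>}" using L(3) ker_\<iota> by blast
    then show False using L(2) by blast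
  next
    case 2
    then show False using L(3) by blast
  qed
qed

lemma inner_on_\<iota>_iff:
  "S.inner_on (carrier S) (\<iota> ` H) {\<one>\<^bsub>S\<^esub>} \<longleftrightarrow> inner_on (carrier G) H K"
proof
  assume L: "S.inner_on (carrier S) (\<iota> ` H) {\<one>\<^bsub>S\<^esub>}"
  show "inner_on (carrier G) H K" unfolding inner_on_def
  proof
    fix g assume g: "g \<in> carrier G"
    then obtain h where h: "h \<in> H"
      "\<And>y. y \<in> H \<Longrightarrow> S.comm (inv\<^bsub>S\<^esub> \<iota> h \<otimes>\<^bsub>S\<^esub> \<sigma> g) (\<iota> y) = \<one>\<^bsub>S\<^esub>"
      using L \<sigma>_simps(1)[OF g] unfolding S.inner_on_def by blast
    have "comm (inv h \<otimes> g) y \<in> K" if y: "y \<in> H" for y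
    proof -
      have "inv h \<otimes> g \<in> carrier G" using h(1) HG g by auto
      then have "comm (inv h \<otimes> g) y \<in> H" using normal_in_comm(1)[OF H subset_refl _ y] by blast
      then show ?thesis using ker_\<iota> h(2)[OF y] \<iota>_comm[OF h(1) g y] by simp
    qed
    then show "\<exists>h\<in>H. \<forall>y\<in>H. comm (inv h \<otimes> g) y \<in> K" using h(1) by blast
  qed
next
  assume R: "inner_on (carrier G) H K"
  show "S.inner_on (carrier S) (\<iota> ` H) {\<one>\<^bsub>S\<^esub>}" unfolding S.inner_on_def
  proof
    fix s assume "s \<in> carrier S"
    then obtain a g where ag: "a \<in> H" "g \<in> carrier G" "s = \<iota> a \<otimes>\<^bsub>S\<^esub> \<sigma> g"
      by (rule carrier_S_cases)
    then obtain h where h: "h \<in> H" "\<And>y. y \<in> H \<Longrightarrow> comm (inv h \<otimes> g) y \<in> K"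
      using R unfolding inner_on_def by blast
    have car: "\<iota> a \<in> carrier S" "\<iota> h \<in> carrier S" "\<sigma> g \<in> carrier S"
      using ag h \<iota>_simps(1) \<sigma>_simps(1) by auto
    \<comment> \<open>\<open>s\<close> is the product of \<open>\<iota> a\<close> and
      \<open>\<sigma> g\<close>. Its first factor acts on the image of \<open>H\<close> as
      conjugation by \<open>a\<close>, which the witness \<open>a \<otimes> h\<close>
      absorbs.\<close>
    have e: "inv\<^bsub>S\<^esub> \<iota> (a \<otimes> h) \<otimes>\<^bsub>S\<^esub> s = inv\<^bsub>S\<^esub> \<iota> h \<otimes>\<^bsub>S\<^esub> \<sigma> g"
      using car ag h(1) \<iota>_simps(2) by (simp add: S.group_word_simps)
    have "S.comm (inv\<^bsub>S\<^esub> \<iota> (a \<otimes> h) \<otimes>\<^bsub>S\<^esub> s) (\<iota> y) \<in> {\<one>\<^bsub>S\<^esub>}" if y: "y \<in> H" for y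
      unfolding e \<iota>_comm[OF h(1) ag(2) y] using ker_\<iota> h(2)[OF y] KH by blast
    moreover have "a \<otimes> h \<in> H" using ag h normal_inD(5)[OF H] by blast
    ultimately show "\<exists>k\<in>\<iota> ` H. \<forall>y\<in>\<iota> ` H. S.comm (inv\<^bsub>S\<^esub> k \<otimes>\<^bsub>S\<^esub> s) y \<in> {\<one>\<^bsub>S\<^esub>}" by blast
  qed
qed

text \<open>By inner action every \<open>g\<close> differs from some \<open>h\<close> in
  \<open>H\<close> by an element centralizing \<open>H/K\<close>, which \<open>\<sigma>\<close>
  kills; so \<open>G\<close> and \<open>H\<close> have the same image under \<open>\<sigma>\<close>.
  The preimage of \<open>U\<close> under \<open>\<sigma>\<close> meets \<open>H\<close> in
  \<open>K\<close> or in \<open>H\<close>. In the first case \<open>U\<close> is the image of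
  \<open>H\<close> under \<open>\<iota>\<close>, in the second it contains everything.\<close>

lemma normal_above_\<iota>:
  assumes inn: "inner_on (carrier G) H K" and U: "S.normal_in (carrier S) U" and HU: "\<iota> ` H \<subseteq> U"
  shows "U = \<iota> ` H \<or> U = carrier S"
proof -
  let ?N = "{g \<in> carrier G. \<sigma> g \<in> U}"
  have N: "normal_in (carrier G) ?N" unfolding normal_in_def
  proof (intro conjI ballI)
    show NG: "?N \<subseteq> carrier G" by blast
    show "subgroup ?N G"
    proof (rule subgroupI[OF NG])
      have "\<one> \<in> ?N"
        using \<sigma>_eq_one normal_inD(4)[OF K] S.normal_inD(4)[OF U] by simp
      then show "?N \<noteq> {}" by blast
      show "inv x \<in> ?N" if "x \<in> ?N" for x
        using that \<sigma>_simps(3) S.normal_inD(6)[OF U] by simp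
      show "x \<otimes> y \<in> ?N" if "x \<in> ?N" "y \<in> ?N" for x y
        using that \<sigma>_simps(2) S.normal_inD(5)[OF U] by simp
    qed
    fix g y assume "g \<in> carrier G" "y \<in> ?N"
    then show "g \<otimes> y \<otimes> inv g \<in> ?N"
      using S.normal_inD(7)[OF U \<sigma>_simps(1)[of g], of "\<sigma> y"] \<sigma>_simps(2,3) by simp
  qed
  have KN: "K \<subseteq> ?N" using \<sigma>_eq_one KG S.normal_inD(4)[OF U] by auto
  have dec: "\<exists>h\<in>H. inv h \<otimes> g \<in> carrier G \<and> \<sigma> g = \<sigma> h" if g: "g \<in> carrier G" for g
  proof -
    obtain h where h: "h \<in> H" "\<And>y. y \<in> H \<Longrightarrow> comm (inv h \<otimes> g) y \<in> K"
      using inn g unfolding inner_on_def by blast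
    have c: "h \<in> carrier G" "inv h \<otimes> g \<in> carrier G" using h(1) HG g by auto
    have "\<sigma> g = \<sigma> (h \<otimes> (inv h \<otimes> g))" using c g by (simp add: mult_inv_cancel)
    also have "\<dots> = \<sigma> h" using \<sigma>_simps(1,2) c ker_\<sigma>[OF c(2) h(2)] by simp
    finally show ?thesis using h(1) c by blast
  qed
  have mem: "h \<in> ?N" if "h \<in> H" "g \<in> ?N" "\<sigma> g = \<sigma> h" for h g using that HG by auto
  have "normal_in (carrier G) (?N \<inter> H)" using normal_in_Int[OF N H] .
  then consider "?N \<inter> H = K" | "?N \<inter> H = H"
    using chief_in_cases[OF chief, of "?N \<inter> H"] KN KH by blast
  then show ?thesis
  proof cases
    case 1
    have "u \<in> \<iota> ` H" if u: "u \<in> U" for u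
    proof -
      have "u \<in> carrier S" using u S.normal_inD(2)[OF U] by blast
      then obtain a g where ag: "a \<in> H" "g \<in> carrier G" "u = \<iota> a \<otimes>\<^bsub>S\<^esub> \<sigma> g"
        by (rule carrier_S_cases)
      have car: "\<iota> a \<in> carrier S" "\<sigma> g \<in> carrier S" using ag \<iota>_simps(1) \<sigma>_simps(1) by auto
      have "inv\<^bsub>S\<^esub> \<iota> a \<otimes>\<^bsub>S\<^esub> u \<in> U" using u ag(1) HU S.normal_inD(5,6)[OF U] by blast
      then have "\<sigma> g \<in> U" using ag(3) car by (simp add: S.mult_inv_cancel)
      then have gN: "g \<in> ?N" using ag by blast
      obtain h where h: "h \<in> H" "\<sigma> g = \<sigma> h" using dec[OF ag(2)] by blast
      have "h \<in> K" using mem[OF h(1) gN h(2)] h(1) 1 by blast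
      then have "\<sigma> g = \<one>\<^bsub>S\<^esub>" using \<sigma>_eq_one h(2) by simp
      then show ?thesis using ag car by simp
    qed
    then show ?thesis using HU by blast
  next
    case 2
    have "s \<in> U" if s: "s \<in> carrier S" for s
    proof -
      obtain a g where ag: "a \<in> H" "g \<in> carrier G" "s = \<iota> a \<otimes>\<^bsub>S\<^esub> \<sigma> g"
        using s by (rule carrier_S_cases)
      obtain h where h: "h \<in> H" "\<sigma> g = \<sigma> h" using dec[OF ag(2)] by blast
      then have "\<sigma> g \<in> U" using 2 by auto
      then show ?thesis using ag HU S.normal_inD(5)[OF U] by blast
    qed
    then show ?thesis using S.normal_inD(2)[OF U] by blast
  qed
qed

text \<open>The image of \<open>H\<close> is a minimal normal subgroup of \<open>S\<close>, with the
  action of \<open>G\<close> on \<open>H/K\<close>; this gives one direction. Conversely, a chief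
  factor above this image has top \<open>S\<close>, so that there each element is its own
  witness.\<close>

lemma quasi_in_iff_inner_on: "S.quasi_in (carrier S) \<longleftrightarrow> inner_on (carrier G) H K"
proof
  assume "S.quasi_in (carrier S)"
  then show "inner_on (carrier G) H K"
    using chief_\<iota> inner_on_\<iota>_iff by (simp add: S.quasi_in_def)
next
  assume inn: "inner_on (carrier G) H K"
  show "S.quasi_in (carrier S)" unfolding S.quasi_in_def
  proof (intro allI impI)
    fix U V assume UV: "S.chief_in (carrier S) U V"
    show "S.inner_on (carrier S) U V"
    proof (rule S.inner_on_chief_extension[OF S.subgroup_self normal_\<iota>
          S.normal_in_self[OF S.subgroup_self] _ _ _ UV])
      show "\<iota> ` H \<subseteq> carrier S" "U \<subseteq> carrier S"
        using S.normal_inD(2) normal_\<iota> UV by (auto simp: S.chief_in_def)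
      show "S.inner_on (carrier S) A B" if AB: "S.chief_in (carrier S) A B" "A \<subseteq> \<iota> ` H" for A B
      proof -
        have n: "S.normal_in (carrier S) A" "S.normal_in (carrier S) B" "B \<subset> A"
          using AB(1) by (auto simp: S.chief_in_def)
        have "B = {\<one>\<^bsub>S\<^esub>}"
          using S.chief_in_cases[OF chief_\<iota> n(2)] S.normal_inD(4)[OF n(2)] n(3) AB(2) by blast
        moreover have "A = \<iota> ` H"
          using S.chief_in_cases[OF chief_\<iota> n(1)] S.normal_inD(4)[OF n(1)] n(3) AB(2) calculation
          by blast
        ultimately show ?thesis using inner_on_\<iota>_iff inn by simp
      qed
      show "S.inner_on (carrier S) A B"
        if AB: "S.chief_in (carrier S) A B" "\<iota> ` H \<subseteq> B" for A B
      proof -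
        have n: "S.normal_in (carrier S) A" "S.normal_in (carrier S) B" "B \<subset> A"
          using AB(1) by (auto simp: S.chief_in_def)
        have A: "A = carrier S" using normal_above_\<iota>[OF inn n(1)] AB(2) n(3) by blast
        have "S.comm (inv\<^bsub>S\<^esub> x \<otimes>\<^bsub>S\<^esub> x) y \<in> B" if "x \<in> carrier S" "y \<in> carrier S" for x y
          using that S.normal_inD(4)[OF n(2)] by simp
        then show ?thesis unfolding S.inner_on_def A by blast
      qed
    qed
  qed
qed

end

section \<open>The intersection of the maximal quasinilpotent subgroups\<close>

context group
begin

section \<open>The semidirect product of the definition as an instance of the extension\<close>

lemma centralizer_factor_eq:
  assumes H: "H \<lhd> G" and K: "K \<lhd> G"
  shows "centralizer_factor G H K = {g \<in> carrier G. \<forall>y\<in>H. comm g y \<in> K}"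
  unfolding centralizer_factor_def carrier_factor using conj_factor_fixed_iff[OF assms] by auto

lemma normal_centralizer_factor:
  assumes H: "H \<lhd> G" and K: "K \<lhd> G"
  shows "centralizer_factor G H K \<lhd> G"
  unfolding centralizer_factor_eq[OF assms]
  using normal_in_centralizer[OF subgroup_self normal_in_self[OF subgroup_self], of K H]
    assms normal_inD(3,7)[of "carrier G" H]
  by (simp add: normal_in_carrier_iff)

lemma central_factor_iff_inner_on:
  assumes fin: "finite (carrier G)" and chief: "chief_in (carrier G) H K"
  shows "central_factor quasinilpotent G H K \<longleftrightarrow> inner_on (carrier G) H K"
proof -
  have H: "H \<lhd> G" and K: "K \<lhd> G" and KH: "K \<subset> H"
    using chief by (auto simp: chief_in_def normal_in_carrier_iff)
  let ?C = "centralizer_factor G H K"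
  define S where
    "S = semidirect_product (factor G H K) (G Mod ?C) (coset_action G H K)"
  \<comment> \<open>Elements are handled through representatives: by \<open>coset_action_eq\<close>
    and \<open>conj_factor_coset\<close> the multiplication is given by words in \<open>G\<close>,
    and the group laws become identities between words.\<close>
  define el where "el h g = (K #> h, ?C #> g)" for h g
  have C: "?C \<lhd> G" using normal_centralizer_factor[OF H K] .
  have sH: "subgroup H G" and sK: "subgroup K G" and sC: "subgroup ?C G"
    using H K C normal_imp_subgroup by auto
  note Hc = subgroup.mem_carrier[OF sH]
  note Hm = subgroup.one_closed[OF sH] subgroup.m_closed[OF sH] subgroup.m_inv_closed[OF sH]
  have Hconj: "g \<otimes> h \<otimes> inv g \<in> H" if "g \<in> carrier G" "h \<in> H" for g h
    using normal.inv_op_closed2[OF H] that by blast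
  have carS: "carrier S = {el h g | h g. h \<in> H \<and> g \<in> carrier G}"
    unfolding S_def semidirect_product_def el_def partial_object.simps carrier_factor carrier_FactGroup
    by auto
  have el: "el h g \<in> carrier S" if "h \<in> H" "g \<in> carrier G" for h g
    unfolding carS using that by blast
  have elE: "\<exists>h g. h \<in> H \<and> g \<in> carrier G \<and> x = el h g" if "x \<in> carrier S" for x
    using that unfolding carS by blast
  have mult: "el h g \<otimes>\<^bsub>S\<^esub> el h' g' = el (h \<otimes> (g \<otimes> h' \<otimes> inv g)) (g \<otimes> g')"
    if "h \<in> H" "g \<in> carrier G" "h' \<in> H" "g' \<in> carrier G" for h g h' g'
  proof -
    have "K #> h <#> (K #> (g \<otimes> h' \<otimes> inv g)) = K #> (h \<otimes> (g \<otimes> h' \<otimes> inv g))"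
      using normal.rcos_sum[OF K] that Hc by simp
    moreover have "?C #> g <#> (?C #> g') = ?C #> (g \<otimes> g')"
      using normal.rcos_sum[OF C] that by simp
    ultimately show ?thesis
      using coset_action_eq[OF H K that(2)] conj_factor_coset[OF H K that(2,3)]
      by (simp add: S_def semidirect_product_def el_def set_mult_def)
  qed
  have one: "\<one>\<^bsub>S\<^esub> = el \<one> \<one>"
    using subgroup.subset[OF sK] subgroup.subset[OF sC]
    by (simp add: S_def semidirect_product_def el_def)
  have gS: "group S"
  proof (rule groupI)
    show "\<one>\<^bsub>S\<^esub> \<in> carrier S" unfolding one using el Hm(1) by simp
  next
    fix x y assume "x \<in> carrier S" "y \<in> carrier S"
    then obtain a b c d where xy: "a \<in> H" "b \<in> carrier G" "x = el a b"
      "c \<in> H" "d \<in> carrier G" "y = el c d"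
      using elE[of x] elE[of y] by auto
    show "x \<otimes>\<^bsub>S\<^esub> y \<in> carrier S"
      using xy(1,2,4,5) unfolding xy(3,6) by (simp add: mult el Hm(2) Hconj)
  next
    fix x y z assume "x \<in> carrier S" "y \<in> carrier S" "z \<in> carrier S"
    then obtain a b c d e f where xyz: "a \<in> H" "b \<in> carrier G" "x = el a b"
      "c \<in> H" "d \<in> carrier G" "y = el c d" "e \<in> H" "f \<in> carrier G" "z = el e f"
      using elE[of x] elE[of y] elE[of z] by auto
    have car: "a \<in> carrier G" "c \<in> carrier G" "e \<in> carrier G" using xyz Hc by auto
    have mem: "a \<otimes> (b \<otimes> c \<otimes> inv b) \<in> H" "c \<otimes> (d \<otimes> e \<otimes> inv d) \<in> H"
      using xyz(1,2,4,5,7) Hm(2) Hconj by auto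
    have "x \<otimes>\<^bsub>S\<^esub> y \<otimes>\<^bsub>S\<^esub> z
        = el (a \<otimes> (b \<otimes> c \<otimes> inv b) \<otimes> (b \<otimes> d \<otimes> e \<otimes> inv (b \<otimes> d))) (b \<otimes> d \<otimes> f)"
      unfolding xyz(3,6,9) using xyz(1,2,4,5,7,8) mem by (simp add: mult)
    also have "\<dots> = el (a \<otimes> (b \<otimes> (c \<otimes> (d \<otimes> e \<otimes> inv d)) \<otimes> inv b)) (b \<otimes> (d \<otimes> f))"
      using car xyz(2,5,8) by (simp add: group_word_simps)
    also have "\<dots> = x \<otimes>\<^bsub>S\<^esub> (y \<otimes>\<^bsub>S\<^esub> z)"
      unfolding xyz(3,6,9) using xyz(1,2,4,5,7,8) mem by (simp add: mult)
    finally show "x \<otimes>\<^bsub>S\<^esub> y \<otimes>\<^bsub>S\<^esub> z = x \<otimes>\<^bsub>S\<^esub> (y \<otimes>\<^bsub>S\<^esub> z)" .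
  next
    fix x assume "x \<in> carrier S"
    then obtain a b where x: "a \<in> H" "b \<in> carrier G" "x = el a b" using elE by blast
    show "\<one>\<^bsub>S\<^esub> \<otimes>\<^bsub>S\<^esub> x = x" using x Hm Hc by (simp add: one mult)
    \<comment> \<open>The first component of the left inverse has to cancel
      \<open>inv b \<otimes> a \<otimes> b\<close>, the image of \<open>a\<close> under the action
      of \<open>inv b\<close>.\<close>
    have i: "inv b \<otimes> inv a \<otimes> b \<in> H" using Hconj[of "inv b" "inv a"] x Hm by simp
    have "el (inv b \<otimes> inv a \<otimes> b) (inv b) \<otimes>\<^bsub>S\<^esub> x = \<one>\<^bsub>S\<^esub>"
      using mult[OF i inv_closed[OF x(2)] x(1,2)] x Hc[OF x(1)] by (simp add: one group_word_simps)
    moreover have "el (inv b \<otimes> inv a \<otimes> b) (inv b) \<in> carrier S" using el i x by simp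
    ultimately show "\<exists>y\<in>carrier S. y \<otimes>\<^bsub>S\<^esub> x = \<one>\<^bsub>S\<^esub>" by blast
  qed
  interpret S: group S by (rule gS)
  have inv_el: "inv\<^bsub>S\<^esub> el \<one> g = el \<one> (inv g)" if g: "g \<in> carrier G" for g
  proof (rule S.inv_equality)
    show "el \<one> (inv g) \<otimes>\<^bsub>S\<^esub> el \<one> g = \<one>\<^bsub>S\<^esub>" using g Hm(1) by (simp add: mult one)
    show "el \<one> g \<in> carrier S" "el \<one> (inv g) \<in> carrier S" using el g Hm(1) by auto
  qed
  interpret chief_factor_extension G S H K "\<lambda>h. el h \<one>" "\<lambda>g. el \<one> g"
  proof unfold_locales
    show "chief_in (carrier G) H K" by (rule chief)
    show "(\<lambda>h. el h \<one>) \<in> hom (G\<lparr>carrier := H\<rparr>) S"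
    proof (rule homI)
      show "el x \<one> \<in> carrier S" if "x \<in> carrier (G\<lparr>carrier := H\<rparr>)" for x
        using el that by simp
      show "el (x \<otimes>\<^bsub>G\<lparr>carrier := H\<rparr>\<^esub> y) \<one> = el x \<one> \<otimes>\<^bsub>S\<^esub> el y \<one>"
        if "x \<in> carrier (G\<lparr>carrier := H\<rparr>)" "y \<in> carrier (G\<lparr>carrier := H\<rparr>)" for x y
        using that Hc by (simp add: mult)
    qed
    show "(\<lambda>g. el \<one> g) \<in> hom G S"
    proof (rule homI)
      show "el \<one> x \<in> carrier S" if "x \<in> carrier G" for x
        using el that Hm(1) by simp
      show "el \<one> (x \<otimes> y) = el \<one> x \<otimes>\<^bsub>S\<^esub> el \<one> y" if "x \<in> carrier G" "y \<in> carrier G" for x y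
        using that Hm(1) by (simp add: mult)
    qed
    have split: "el h \<one> \<otimes>\<^bsub>S\<^esub> el \<one> g = el h g" if "h \<in> H" "g \<in> carrier G" for h g
      using that Hm(1) Hc by (simp add: mult)
    then show "carrier S = {el h \<one> \<otimes>\<^bsub>S\<^esub> el \<one> g | h g. h \<in> H \<and> g \<in> carrier G}"
      unfolding carS by force
    fix g h assume g: "g \<in> carrier G"
    show "el \<one> g \<otimes>\<^bsub>S\<^esub> el h \<one> \<otimes>\<^bsub>S\<^esub> inv\<^bsub>S\<^esub> el \<one> g = el (g \<otimes> h \<otimes> inv g) \<one>" if "h \<in> H"
      using g that Hm(1) Hc Hconj[OF g that] by (simp add: mult inv_el)
    show "el \<one> g = \<one>\<^bsub>S\<^esub>" if "\<And>y. y \<in> H \<Longrightarrow> comm g y \<in> K"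
    proof -
      have "g \<in> ?C" using centralizer_factor_eq[OF H K] g that by blast
      then have "?C #> g = ?C #> \<one>" using coset_join2[OF _ sC] g subgroup.one_closed[OF sC] by simp
      then show ?thesis by (simp add: one el_def)
    qed
  next
    fix h assume h: "h \<in> H"
    have "el h \<one> = \<one>\<^bsub>S\<^esub> \<longleftrightarrow> K #> h = K #> \<one>" by (simp add: one el_def)
    also have "\<dots> \<longleftrightarrow> h \<in> K" using r_coset_eq_iff[OF sK Hc[OF h] one_closed] Hc[OF h] by simp
    finally show "el h \<one> = \<one>\<^bsub>S\<^esub> \<longleftrightarrow> h \<in> K" .
  qed
  have "finite (H \<times> carrier G)" using fin finite_subset[OF subgroup.subset[OF sH]] by blast
  moreover have "carrier S = (\<lambda>(h, g). el h g) ` (H \<times> carrier G)" unfolding carS by auto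
  ultimately have "finite (carrier S)" by simp
  then have "quasinilpotent S \<longleftrightarrow> inner_on (carrier G) H K"
    using S.quasinilpotent_iff quasi_in_iff_inner_on by simp
  then show ?thesis by (simp add: central_factor_def S_def)
qed

lemma hypercentral_quasinilpotent_iff:
  assumes fin: "finite (carrier G)"
  shows "hypercentral quasinilpotent G N \<longleftrightarrow> normal_in (carrier G) N \<and>
    (\<forall>H K. chief_in (carrier G) H K \<longrightarrow> H \<subseteq> N \<longrightarrow> inner_on (carrier G) H K)"
proof -
  \<comment> \<open>For the trivial subgroup the condition on chief factors holds vacuously.\<close>
  have "\<not> H \<subseteq> {\<one>}" if "chief_in (carrier G) H K" for H K
    using that normal_inD(4)[of "carrier G" K] by (auto simp: chief_in_def)
  then show ?thesis
    unfolding hypercentral_def chief_factor_iff normal_in_carrier_iff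
    using central_factor_iff_inner_on[OF fin] by blast
qed

section \<open>Maximal quasinilpotent subgroups and their intersection\<close>

lemma maximal_quasinilpotent_subgroup_iff:
  assumes fin: "finite (carrier G)"
  shows "maximal_quasinilpotent_subgroup M G \<longleftrightarrow> subgroup M G \<and> quasi_in M \<and>
    (\<forall>L. subgroup L G \<longrightarrow> quasi_in L \<longrightarrow> \<not> M \<subset> L)"
  unfolding maximal_quasinilpotent_subgroup_def
  by (auto simp: quasinilpotent_subgroup_iff[OF fin] cong: conj_cong)

lemma ex_maximal_quasinilpotent_subgroup:
  assumes fin: "finite (carrier G)" and X: "subgroup X G" "quasi_in X"
  shows "\<exists>M. maximal_quasinilpotent_subgroup M G \<and> X \<subseteq> M"
proof -
  have "\<exists>M. (subgroup M G \<and> quasi_in M) \<and> X \<subseteq> M \<and>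
      (\<forall>L. subgroup L G \<and> quasi_in L \<longrightarrow> M \<subseteq> L \<longrightarrow> L = M)"
    using X subgroup.subset by (intro ex_maximal_set[OF fin]) auto
  then obtain M where "subgroup M G" "quasi_in M" "X \<subseteq> M"
    and max: "\<And>L. subgroup L G \<and> quasi_in L \<Longrightarrow> M \<subseteq> L \<Longrightarrow> L = M" by auto
  moreover have "\<not> M \<subset> L" if "subgroup L G" "quasi_in L" for L
    using max[of L] that by blast
  ultimately have "maximal_quasinilpotent_subgroup M G"
    by (simp add: maximal_quasinilpotent_subgroup_iff[OF fin])
  then show ?thesis using \<open>X \<subseteq> M\<close> by blast
qed

lemma maximal_quasinilpotent_subgroup_conj_by:
  assumes fin: "finite (carrier G)" and g: "g \<in> carrier G"
    and M: "maximal_quasinilpotent_subgroup M G"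
  shows "maximal_quasinilpotent_subgroup (conj_by g ` M) G"
proof -
  have m: "subgroup M G" "quasi_in M" "\<And>L. subgroup L G \<Longrightarrow> quasi_in L \<Longrightarrow> \<not> M \<subset> L"
    using M unfolding maximal_quasinilpotent_subgroup_iff[OF fin] by auto
  have MG: "M \<subseteq> carrier G" using subgroup.subset[OF m(1)] .
  have ig: "inv g \<in> carrier G" using g by simp
  have "\<not> conj_by g ` M \<subset> L" if L: "subgroup L G" "quasi_in L" for L
  proof
    assume "conj_by g ` M \<subset> L"
    then have "conj_by (inv g) ` conj_by g ` M \<subset> conj_by (inv g) ` L"
      by (rule image_strict_mono[OF conj_by_inj[OF ig subgroup.subset[OF L(1)]]])
    then have "M \<subset> conj_by (inv g) ` L" using conj_by_inverse[OF g MG] by simp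
    then show False
      using m(3)[OF subgroup_conj_by[OF ig L(1)]
          quasi_in_conj_by[OF ig subgroup.subset[OF L(1)] L(2)]] by simp
  qed
  then show ?thesis
    using subgroup_conj_by[OF g m(1)] quasi_in_conj_by[OF g MG m(2)]
    by (simp add: maximal_quasinilpotent_subgroup_iff[OF fin])
qed

lemma quasi_in_cyclic:
  assumes g: "g \<in> carrier G"
  shows "quasi_in (generate G {g})"
proof (rule quasi_in_abelian)
  show "subgroup (generate G {g}) G" using g by (intro generate_is_subgroup) simp
  fix x y assume "x \<in> generate G {g}" "y \<in> generate G {g}"
  then obtain i j :: int where ij: "x = g [^] i" "y = g [^] j"
    using generate_pow[OF g] by auto
  then have "x \<otimes> y = y \<otimes> x" using g int_pow_mult[of g i j] int_pow_mult[of g j i]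
    by (simp add: add.commute)
  then show "comm x y = \<one>" using g ij by (simp add: comm_def m_assoc flip: inv_mult_group)
qed

lemma normal_in_Inter_maximal_quasinilpotent:
  assumes fin: "finite (carrier G)"
  shows "normal_in (carrier G) (\<Inter>{M. maximal_quasinilpotent_subgroup M G})"
    (is "normal_in _ (\<Inter>?F)")
proof -
  have sub: "subgroup M G" if "M \<in> ?F" for M
    using that by (simp add: maximal_quasinilpotent_subgroup_def)
  \<comment> \<open>The family must be nonempty, since an empty intersection would be the universal
    set of the type.\<close>
  have "quasi_in {\<one>}" by (rule quasi_in_abelian[OF triv_subgroup]) simp
  then have ne: "?F \<noteq> {}"
    using ex_maximal_quasinilpotent_subgroup[OF fin triv_subgroup] by blast
  show ?thesis unfolding normal_in_def
  proof (intro conjI ballI)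
    show s: "subgroup (\<Inter>?F) G" using subgroups_Inter[of ?F] sub ne by blast
    show "\<Inter>?F \<subseteq> carrier G" using subgroup.subset[OF s] .
    fix g x assume g: "g \<in> carrier G" and x: "x \<in> \<Inter>?F"
    have "g \<otimes> x \<otimes> inv g \<in> M" if M: "M \<in> ?F" for M
    proof -
      have ig: "inv g \<in> carrier G" using g by simp
      \<comment> \<open>Conjugates of members are members, so \<open>x\<close> lies in this one;
        conjugating back by \<open>g\<close> lands in \<open>M\<close>.\<close>
      have "conj_by (inv g) ` M \<in> ?F"
        using maximal_quasinilpotent_subgroup_conj_by[OF fin ig] M by simp
      then have "x \<in> conj_by (inv g) ` M" using x by blast
      then have "conj_by g x \<in> conj_by g ` conj_by (inv g) ` M" by (rule imageI)
      then show ?thesis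
        using conj_by_inverse[OF ig subgroup.subset[OF sub[OF M]]] g by (simp add: conj_by_def)
    qed
    then show "g \<otimes> x \<otimes> inv g \<in> \<Inter>?F" by blast
  qed
qed

lemma Inter_maximal_quasinilpotent_hypercentral:
  assumes fin: "finite (carrier G)"
  shows "hypercentral quasinilpotent G (\<Inter>{M. maximal_quasinilpotent_subgroup M G})"
    (is "hypercentral _ _ ?D")
  unfolding hypercentral_quasinilpotent_iff[OF fin]
proof (intro conjI allI impI)
  show "normal_in (carrier G) ?D" by (rule normal_in_Inter_maximal_quasinilpotent[OF fin])
  fix H K assume chief: "chief_in (carrier G) H K" and HD: "H \<subseteq> ?D"
  show "inner_on (carrier G) H K"
  proof (rule inner_on_chief_factor_cover[OF fin chief])
    fix g assume g: "g \<in> carrier G"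
    have "subgroup (generate G {g}) G" using g by (intro generate_is_subgroup) simp
    then obtain M where M: "maximal_quasinilpotent_subgroup M G" "generate G {g} \<subseteq> M"
      using ex_maximal_quasinilpotent_subgroup[OF fin _ quasi_in_cyclic[OF g]] by blast
    have "g \<in> M" using M(2) generate.incl[of g "{g}" G] by blast
    moreover have "H \<subseteq> M" using HD M(1) by blast
    ultimately show "\<exists>M. subgroup M G \<and> quasi_in M \<and> g \<in> M \<and> H \<subseteq> M"
      using M(1) maximal_quasinilpotent_subgroup_iff[OF fin] by blast
  qed
qed

lemma hypercentral_subset_maximal_quasinilpotent:
  assumes fin: "finite (carrier G)" and N: "hypercentral quasinilpotent G N"
    and M: "maximal_quasinilpotent_subgroup M G"
  shows "N \<subseteq> M"
proof -
  have n: "normal_in (carrier G) N"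
    "\<And>H K. chief_in (carrier G) H K \<Longrightarrow> H \<subseteq> N \<Longrightarrow> inner_on (carrier G) H K"
    using N unfolding hypercentral_quasinilpotent_iff[OF fin] by auto
  have m: "subgroup M G" "quasi_in M" "\<And>L. subgroup L G \<Longrightarrow> quasi_in L \<Longrightarrow> \<not> M \<subset> L"
    using M unfolding maximal_quasinilpotent_subgroup_iff[OF fin] by auto
  have "subgroup (M <#> N) G" "quasi_in (M <#> N)"
    by (rule quasi_in_set_mult[OF fin n(1) _ m(1,2)], erule (1) n(2))+
  then have "\<not> M \<subset> M <#> N" by (rule m(3))
  then show ?thesis using subset_set_mult[OF m(1) normal_inD(1)[OF n(1)]] by blast
qed

end

theorem corollary1:
  fixes G :: "('a, 'b) monoid_scheme"
  assumes "group G" and "finite (carrier G)"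
  shows "\<Inter>{M. maximal_quasinilpotent_subgroup M G} = hypercenter quasinilpotent G"
proof -
  interpret group G by (rule assms)
  note fin = \<open>finite (carrier G)\<close>
  let ?D = "\<Inter>{M. maximal_quasinilpotent_subgroup M G}"
  have "hypercentral quasinilpotent G ?D"
    by (rule Inter_maximal_quasinilpotent_hypercentral[OF fin])
  \<comment> \<open>\<open>?D\<close> is itself one of the subgroups that generate the
    hypercenter.\<close>
  then have "?D \<subseteq> hypercenter quasinilpotent G"
    unfolding hypercenter_def by (blast intro: generate.incl)
  moreover have "hypercenter quasinilpotent G \<subseteq> ?D"
    unfolding hypercenter_def
  proof (rule generate_subgroup_incl)
    show "\<Union>{N. hypercentral quasinilpotent G N} \<subseteq> ?D"
      using hypercentral_subset_maximal_quasinilpotent[OF fin] by blast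
    show "subgroup ?D G"
      using normal_inD(1)[OF normal_in_Inter_maximal_quasinilpotent[OF fin]] .
  qed
  ultimately show ?thesis by blast
qed

end
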